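(* Let $G$ be any graph. Let $\Psi:\mathcal U/{\asymp}\to\mathfrak F$ be the map that is the identity on ends and sends each class $[v]_\asymp$ ($v\in\Upsilon$) to the unique element $\mathfrak v=(\mathcal F_X)_X\in\mathfrak F\setminus\Omega$ whose least element $X$ with $\mathcal F_X$ non-principal is $X_v$. Then $\Psi\cup\mathrm{id}_G$ is a well-defined homeomorphism between the quotient space $\vartheta G/{\asymp}$ and $\mathfrak FG$.
   Context: $G$ is a 1-complex (edges copies of $[0,1]$, inner points with usual neighbourhoods, vertex neighbourhoods unions of half-open intervals $[u,j_e)$ at the vertex). $\mathcal X$: finite subsets of $V(G)$; $\mathcal C_X$: components of $G-X$; $\phi_{X',X}$ sends a component of $G-X'$ to the component of $G-X$ containing it; $c_X(C)$ the principal ultrafilter on $\mathcal C_X$ of $\{C\}$. Tangle compactification: $\mathcal U_X$ all ultrafilters on $\mathcal C_X$; $f_{X',X}(U')=\{\mathcal C:\exists\mathcal C'\in U',\mathcal C\supseteq\phi_{X',X}[\mathcal C']\}$; $\mathcal U=\varprojlim\mathcal U_X$; $\vartheta G=G\cup\mathcal U$ with the topology generated by the 1-complex open sets and sets $\bigcup\mathcal C\cup\mathring E(X,\bigcup\mathcal C)\cup\{(U_Y)_Y:\mathcal C\in U_X\}$ ($\mathcal C\subseteq\mathcal C_X$, $\mathring E(X,\bigcup\mathcal C)$ inner points of edges between $X$ and $\bigcup\mathcal C$). Elements with all $U_X$ principal are the ends ($\Omega$); $\Upsilon=\mathcal U\setminus\Omega$; for $v\in\Upsilon$, $X_v$ is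 the least $X$ with $U_X$ non-principal. $v\asymp v'$ iff $X_v=X_{v'}$ ($v,v'\in\Upsilon$); all other points of $\vartheta G$ are $\asymp$-equivalent only to themselves. $\mathfrak FG$: $\mathcal C_X(Y)$ components of $G-X$ with neighbourhood exactly $Y$; $\mathrm{crit}(X)=\{Y\subseteq X:\mathcal C_X(Y)\text{ infinite}\}$; $\mathcal F_X(Y)$ the sets $\mathcal C\subseteq\mathcal C_X$ containing a cofinite subset of $\mathcal C_X(Y)$; $\mathfrak F_X=\{c_X(C)\}\cup\{\mathcal F_X(Y):Y\in\mathrm{crit}(X)\}$; $\mathfrak f_{X',X}(c_{X'}(C'))=c_X(\phi_{X',X}(C'))$, $\mathfrak f_{X',X}(\mathcal F_{X'}(Y))=\mathcal F_X(Y)$ if $Y\subseteq X$, else $c_X(C)$ with $C\supseteq\bigcup\mathcal C_{X'}(Y)$; $\mathfrak F=\varprojlim\mathfrak F_X$, ends identified with $(c_X(C(X,\omega)))_X$. $\mathfrak FG=G\cup\mathfrak F$ with the topology generated by the 1-complex open sets and the sets $\bigcup\mathcal C\cup\mathring E(X,\bigcup\mathcal C)\cup\{(\mathcal F_Y)_Y\in\mathfrak F:\mathcal C\in\mathcal F_X\}$ where $\mathcal C$ is a singleton subset of $\mathcal C_X$ or a cofinite subset of some $\mathcal C_X(Y)$, $Y\in\mathrm{crit}(X)$. (For each $v\in\Upsilon$, $X_v$ is critical, and there is exactly one element of $\mathfrak F\setminus\Omega$ as described in the claim.) *)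

theory Defs
  imports "HOL-Analysis.Analysis"
begin

type_synonym 'v ugraph = "'v set \<times> 'v set set"

abbreviation verts :: "'v ugraph \<Rightarrow> 'v set" where "verts \<equiv> fst"
abbreviation edges :: "'v ugraph \<Rightarrow> 'v set set" where "edges \<equiv> snd"

definition simple_graph :: "'v ugraph \<Rightarrow> bool" where
  "simple_graph G \<longleftrightarrow> (\<forall>e\<in>edges G. e \<subseteq> verts G \<and> card e = 2)"

definition fin_vsets :: "'v ugraph \<Rightarrow> 'v set set" where
  "fin_vsets G = {X. finite X \<and> X \<subseteq> verts G}"

text \<open>Components are represented by their vertex sets; as subgraphs they are the
  subgraphs of \<open>G\<close> induced on these sets.\<close>

definition adj_minus :: "'v ugraph \<Rightarrow> 'v set \<Rightarrow> ('v \<times> 'v) set" where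
  "adj_minus G X = {(u, v). u \<in> verts G - X \<and> v \<in> verts G - X \<and> {u, v} \<in> edges G}"

definition comps :: "'v ugraph \<Rightarrow> 'v set \<Rightarrow> 'v set set" where
  "comps G X = (\<lambda>u. {v. (u, v) \<in> (adj_minus G X)\<^sup>*}) ` (verts G - X)"

definition nbhd :: "'v ugraph \<Rightarrow> 'v set \<Rightarrow> 'v set" where
  "nbhd G C = {x \<in> verts G - C. \<exists>c\<in>C. {x, c} \<in> edges G}"

definition comp_map :: "'v ugraph \<Rightarrow> 'v set \<Rightarrow> 'v set \<Rightarrow> 'v set \<Rightarrow> 'v set" where
  "comp_map G X' X C' = (THE C. C \<in> comps G X \<and> C' \<subseteq> C)"


text \<open>Points are given by barycentric coordinates with respect to the vertices. For an edge
  \<open>{u, v}\<close> the map \<open>edge_pt u v\<close> identifies \<open>[0,1]\<close> with that edge, sending \<open>0\<close> to \<open>u\<close> and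
  \<open>1\<close> to \<open>v\<close>; reversing the edge gives \<open>edge_pt v u t = edge_pt u v (1 - t)\<close>.\<close>

type_synonym 'v point = "'v \<Rightarrow> real"

definition vertex_pt :: "'v \<Rightarrow> 'v point" where
  "vertex_pt u = (\<lambda>w. if w = u then 1 else 0)"

definition edge_pt :: "'v \<Rightarrow> 'v \<Rightarrow> real \<Rightarrow> 'v point" where
  "edge_pt u v t = (\<lambda>w. if w = u then 1 - t else if w = v then t else 0)"

definition inner_pts :: "'v set \<Rightarrow> 'v point set" where
  "inner_pts e = {edge_pt u v t | u v t. e = {u, v} \<and> 0 < t \<and> t < 1}"

definition realization :: "'v ugraph \<Rightarrow> 'v set \<Rightarrow> 'v point set" where
  "realization G W = vertex_pt ` (W \<inter> verts G) \<union> \<Union> (inner_pts ` {e \<in> edges G. e \<subseteq> W})"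

definition inner_between :: "'v ugraph \<Rightarrow> 'v set \<Rightarrow> 'v set \<Rightarrow> 'v point set" where
  "inner_between G X W = \<Union> (inner_pts ` {e \<in> edges G. \<exists>x\<in>X. \<exists>w\<in>W. e = {x, w}})"

definition open_segment_pts :: "'v \<Rightarrow> 'v \<Rightarrow> real \<Rightarrow> real \<Rightarrow> 'v point set" where
  "open_segment_pts u v a b = {edge_pt u v t | t. a < t \<and> t < b}"

definition open_star_pts :: "'v ugraph \<Rightarrow> 'v \<Rightarrow> ('v \<Rightarrow> real) \<Rightarrow> 'v point set" where
  "open_star_pts G u j =
     insert (vertex_pt u) {edge_pt u v t | v t. {u, v} \<in> edges G \<and> 0 \<le> t \<and> t < j v}"

definition complex_topology :: "'v ugraph \<Rightarrow> 'v point topology" where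
  "complex_topology G = topology_generated_by
     ({open_segment_pts u v a b | u v a b. {u, v} \<in> edges G \<and> 0 \<le> a \<and> a < b \<and> b \<le> 1} \<union>
      {open_star_pts G u j | u j. u \<in> verts G \<and> (\<forall>v. 0 < j v \<and> j v < 1)})"


definition ultrafilter_on :: "'a set \<Rightarrow> 'a set set \<Rightarrow> bool" where
  "ultrafilter_on S U \<longleftrightarrow>
     U \<subseteq> Pow S \<and> S \<in> U \<and> {} \<notin> U \<and>
     (\<forall>A\<in>U. \<forall>B\<in>U. A \<inter> B \<in> U) \<and>
     (\<forall>A\<in>U. \<forall>B. A \<subseteq> B \<and> B \<subseteq> S \<longrightarrow> B \<in> U) \<and>
     (\<forall>A. A \<subseteq> S \<longrightarrow> A \<in> U \<or> S - A \<in> U)"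

text \<open>Families indexed by the finite vertex sets are functions that are \<open>undefined\<close> on all
  other sets (extensional functions).\<close>

type_synonym 'v family = "'v set \<Rightarrow> 'v set set set"

definition princ :: "'v ugraph \<Rightarrow> 'v set \<Rightarrow> 'v set \<Rightarrow> 'v set set set" where
  "princ G X C = {A. A \<subseteq> comps G X \<and> C \<in> A}"

definition is_princ :: "'v ugraph \<Rightarrow> 'v set \<Rightarrow> 'v set set set \<Rightarrow> bool" where
  "is_princ G X F \<longleftrightarrow> (\<exists>C\<in>comps G X. F = princ G X C)"

definition ultra_map :: "'v ugraph \<Rightarrow> 'v set \<Rightarrow> 'v set \<Rightarrow> 'v set set set \<Rightarrow> 'v set set set" where
  "ultra_map G X' X U' = {A. A \<subseteq> comps G X \<and> (\<exists>A'\<in>U'. comp_map G X' X ` A' \<subseteq> A)}"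

definition ultra_limit :: "'v ugraph \<Rightarrow> 'v family set" where
  "ultra_limit G =
     {U \<in> (\<Pi>\<^sub>E X\<in>fin_vsets G. {F. ultrafilter_on (comps G X) F}).
        \<forall>X\<in>fin_vsets G. \<forall>X'\<in>fin_vsets G. X \<subseteq> X' \<longrightarrow> ultra_map G X' X (U X') = U X}"

definition ends :: "'v ugraph \<Rightarrow> 'v family set" where
  "ends G = {U \<in> ultra_limit G. \<forall>X\<in>fin_vsets G. is_princ G X (U X)}"

definition ultra_tangles :: "'v ugraph \<Rightarrow> 'v family set" where
  "ultra_tangles G = ultra_limit G - ends G"

definition least_nonprinc :: "'v ugraph \<Rightarrow> 'v family \<Rightarrow> 'v set \<Rightarrow> bool" where
  "least_nonprinc G F X \<longleftrightarrow>
     X \<in> fin_vsets G \<and> \<not> is_princ G X (F X) \<and>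
     (\<forall>X'\<in>fin_vsets G. \<not> is_princ G X' (F X') \<longrightarrow> X \<subseteq> X')"

definition X_of :: "'v ugraph \<Rightarrow> 'v family \<Rightarrow> 'v set" where
  "X_of G v = (THE X. least_nonprinc G v X)"

definition basic_open ::
  "'v ugraph \<Rightarrow> 'v family set \<Rightarrow> 'v set \<Rightarrow> 'v set set \<Rightarrow> ('v point + 'v family) set" where
  "basic_open G L X \<C> =
     Inl ` (realization G (\<Union>\<C>) \<union> inner_between G X (\<Union>\<C>)) \<union> Inr ` {F \<in> L. \<C> \<in> F X}"

definition theta :: "'v ugraph \<Rightarrow> ('v point + 'v family) topology" where
  "theta G = topology_generated_by
     ({Inl ` A | A. openin (complex_topology G) A} \<union>
      {basic_open G (ultra_limit G) X \<C> | X \<C>. X \<in> fin_vsets G \<and> \<C> \<subseteq> comps G X})"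

definition asymp_rel :: "'v ugraph \<Rightarrow> (('v point + 'v family) \<times> ('v point + 'v family)) set" where
  "asymp_rel G = Id_on (topspace (theta G)) \<union>
     {(Inr v, Inr v') | v v'. v \<in> ultra_tangles G \<and> v' \<in> ultra_tangles G \<and> X_of G v = X_of G v'}"

definition quotient_topology :: "'a topology \<Rightarrow> ('a \<times> 'a) set \<Rightarrow> 'a set topology" where
  "quotient_topology T r = topology (\<lambda>S. S \<subseteq> topspace T // r \<and> openin T {x \<in> topspace T. r `` {x} \<in> S})"


definition comps_with_nbhd :: "'v ugraph \<Rightarrow> 'v set \<Rightarrow> 'v set \<Rightarrow> 'v set set" where
  "comps_with_nbhd G X Y = {C \<in> comps G X. nbhd G C = Y}"

definition crit :: "'v ugraph \<Rightarrow> 'v set \<Rightarrow> 'v set set" where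
  "crit G X = {Y. Y \<subseteq> X \<and> infinite (comps_with_nbhd G X Y)}"

definition cofin_subset :: "'a set \<Rightarrow> 'a set \<Rightarrow> bool" where
  "cofin_subset B S \<longleftrightarrow> B \<subseteq> S \<and> finite (S - B)"

definition crit_filter :: "'v ugraph \<Rightarrow> 'v set \<Rightarrow> 'v set \<Rightarrow> 'v set set set" where
  "crit_filter G X Y = {A. A \<subseteq> comps G X \<and> (\<exists>B\<subseteq>A. cofin_subset B (comps_with_nbhd G X Y))}"

definition crit_filters :: "'v ugraph \<Rightarrow> 'v set \<Rightarrow> 'v set set set set" where
  "crit_filters G X = princ G X ` comps G X \<union> crit_filter G X ` crit G X"

definition crit_map :: "'v ugraph \<Rightarrow> 'v set \<Rightarrow> 'v set \<Rightarrow> 'v set set set \<Rightarrow> 'v set set set" where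
  "crit_map G X' X F' = (THE F.
     (\<exists>C'\<in>comps G X'. F' = princ G X' C' \<and> F = princ G X (comp_map G X' X C')) \<or>
     (\<exists>Y\<in>crit G X'. F' = crit_filter G X' Y \<and>
        (if Y \<subseteq> X then F = crit_filter G X Y
         else \<exists>C\<in>comps G X. \<Union> (comps_with_nbhd G X' Y) \<subseteq> C \<and> F = princ G X C)))"

definition crit_limit :: "'v ugraph \<Rightarrow> 'v family set" where
  "crit_limit G =
     {F \<in> (\<Pi>\<^sub>E X\<in>fin_vsets G. crit_filters G X).
        \<forall>X\<in>fin_vsets G. \<forall>X'\<in>fin_vsets G. X \<subseteq> X' \<longrightarrow> crit_map G X' X (F X') = F X}"

definition crit_space :: "'v ugraph \<Rightarrow> ('v point + 'v family) topology" where
  "crit_space G = topology_generated_by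
     ({Inl ` A | A. openin (complex_topology G) A} \<union>
      {basic_open G (crit_limit G) X {C} | X C. X \<in> fin_vsets G \<and> C \<in> comps G X} \<union>
      {basic_open G (crit_limit G) X \<C> | X \<C> Y. X \<in> fin_vsets G \<and> Y \<in> crit G X \<and>
         cofin_subset \<C> (comps_with_nbhd G X Y)})"


definition Psi_rep :: "'v ugraph \<Rightarrow> 'v family \<Rightarrow> 'v family" where
  "Psi_rep G v =
     (if v \<in> ends G then v
      else THE F. F \<in> crit_limit G - ends G \<and> least_nonprinc G F (X_of G v))"

definition Psi_id_rep :: "'v ugraph \<Rightarrow> 'v point + 'v family \<Rightarrow> 'v point + 'v family" where
  "Psi_id_rep G = map_sum id (Psi_rep G)"

text \<open>The value on a class is that of any representative; the image of a class is a singleton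
  because \<open>Psi_id_rep G\<close> respects the relation.\<close>

definition Psi_id :: "'v ugraph \<Rightarrow> ('v point + 'v family) set \<Rightarrow> 'v point + 'v family" where
  "Psi_id G K = the_elem (Psi_id_rep G ` K)"


lemma istopology_quotient:
  "istopology (\<lambda>S. S \<subseteq> topspace T // r \<and> openin T {x \<in> topspace T. r `` {x} \<in> S})"
proof -
  have "{x \<in> topspace T. r `` {x} \<in> S \<inter> S'} =
        {x \<in> topspace T. r `` {x} \<in> S} \<inter> {x \<in> topspace T. r `` {x} \<in> S'}" for S S'
    by auto
  moreover have "{x \<in> topspace T. r `` {x} \<in> \<Union>\<K>} = (\<Union>S\<in>\<K>. {x \<in> topspace T. r `` {x} \<in> S})" for \<K>
    by auto
  ultimately show ?thesis
    unfolding istopology_def by (auto simp del: Union_iff)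
qed

lemma openin_quotient_topology:
  "openin (quotient_topology T r) S \<longleftrightarrow>
     S \<subseteq> topspace T // r \<and> openin T {x \<in> topspace T. r `` {x} \<in> S}"
  unfolding quotient_topology_def by (simp add: topology_inverse' [OF istopology_quotient])

lemma topspace_quotient_topology: "topspace (quotient_topology T r) = topspace T // r"
proof (rule antisym)
  show "topspace (quotient_topology T r) \<subseteq> topspace T // r"
    using openin_quotient_topology openin_topspace by blast
  have "{x \<in> topspace T. r `` {x} \<in> topspace T // r} = topspace T"
    by (auto intro: quotientI)
  then have "openin (quotient_topology T r) (topspace T // r)"
    by (simp add: openin_quotient_topology)
  then show "topspace T // r \<subseteq> topspace (quotient_topology T r)"
    by (rule openin_subset)
qed

lemma quotient_map_class:
  "quotient_map T (quotient_topology T r) (\<lambda>x. r `` {x})"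
  by (auto simp: quotient_map_def topspace_quotient_topology openin_quotient_topology quotient_def)

lemma edge_pt_0: "edge_pt u v 0 = vertex_pt u"
  by (auto simp: edge_pt_def vertex_pt_def)

lemma edge_pt_1: "u \<noteq> v \<Longrightarrow> edge_pt u v 1 = vertex_pt v"
  by (auto simp: edge_pt_def vertex_pt_def)

lemma edge_pt_swap: "u \<noteq> v \<Longrightarrow> edge_pt v u t = edge_pt u v (1 - t)"
  by (auto simp: edge_pt_def)

lemma topspace_complex_topology:
  assumes "simple_graph G"
  shows "topspace (complex_topology G) = realization G (verts G)"
proof -
  have E: "u \<in> verts G \<and> v \<in> verts G \<and> u \<noteq> v" if "{u, v} \<in> edges G" for u v
  proof -
    have "{u, v} \<subseteq> verts G" "card {u, v} = 2"
      using assms that unfolding simple_graph_def by blast+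
    then show ?thesis by (cases "u = v") auto
  qed
  have innerI: "edge_pt u v t \<in> realization G (verts G)"
    if "{u, v} \<in> edges G" "0 < t" "t < 1" for u v t
  proof -
    have "edge_pt u v t \<in> inner_pts {u, v}" using that unfolding inner_pts_def by blast
    then show ?thesis using E[OF that(1)] that(1) unfolding realization_def by blast
  qed
  have vertI: "vertex_pt u \<in> realization G (verts G)" if "u \<in> verts G" for u
    using that by (auto simp: realization_def)
  show ?thesis
  proof (rule antisym)
    show "topspace (complex_topology G) \<subseteq> realization G (verts G)"
    proof
      fix p assume "p \<in> topspace (complex_topology G)"
      then consider
        (seg) u v a b t where "{u, v} \<in> edges G" "0 \<le> a" "b \<le> 1" "a < t" "t < b" "p = edge_pt u v t"
      | (vert) u where "u \<in> verts G" "p = vertex_pt u"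
      | (star) u v t j where "{u, v} \<in> edges G" "u \<in> verts G" "0 \<le> t" "t < j v" "j v < 1"
          "p = edge_pt u v t"
        unfolding complex_topology_def topology_generated_by_topspace
          open_segment_pts_def open_star_pts_def by blast
      then show "p \<in> realization G (verts G)"
      proof cases
        case seg then show ?thesis using innerI by auto
      next
        case vert then show ?thesis by (simp add: vertI)
      next
        case star then show ?thesis
          by (cases "t = 0") (auto simp: innerI vertI edge_pt_0)
      qed
    qed
    show "realization G (verts G) \<subseteq> topspace (complex_topology G)"
    proof
      fix p assume "p \<in> realization G (verts G)"
      then consider (vert) u where "u \<in> verts G" "p = vertex_pt u"
        | (inner) u v t where "{u, v} \<in> edges G" "0 < t" "t < 1" "p = edge_pt u v t"
        unfolding realization_def inner_pts_def by auto
      then show "p \<in> topspace (complex_topology G)"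
      proof cases
        case vert
        then have "p \<in> open_star_pts G u (\<lambda>_. 1/2)" by (simp add: open_star_pts_def)
        moreover have "open_star_pts G u (\<lambda>_. 1/2) \<in>
            {open_star_pts G u j | u j. u \<in> verts G \<and> (\<forall>v. 0 < j v \<and> j v < 1)}"
          using vert(1) by force
        ultimately show ?thesis
          unfolding complex_topology_def topology_generated_by_topspace by blast
      next
        case inner
        then have "p \<in> open_segment_pts u v 0 1" by (auto simp: open_segment_pts_def)
        moreover have "open_segment_pts u v 0 1 \<in>
            {open_segment_pts u v a b | u v a b. {u, v} \<in> edges G \<and> 0 \<le> a \<and> a < b \<and> b \<le> 1}"
          using inner(1) by force
        ultimately show ?thesis
          unfolding complex_topology_def topology_generated_by_topspace by blast
      qed
    qed
  qed
qed

lemma basic_open_subset: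
  assumes "X \<subseteq> verts G" "\<Union>\<C> \<subseteq> verts G"
  shows "basic_open G L X \<C> \<subseteq> Inl ` realization G (verts G) \<union> Inr ` L"
proof -
  have "realization G (\<Union>\<C>) \<subseteq> realization G (verts G)"
    unfolding realization_def using assms(2) by (intro Un_mono Union_mono image_mono) auto
  moreover have "inner_between G X (\<Union>\<C>) \<subseteq> realization G (verts G)"
    unfolding realization_def inner_between_def using assms
    by (intro le_supI2 Union_mono image_mono) auto
  ultimately show ?thesis
    unfolding basic_open_def by blast
qed

lemma comps_subset: "C \<in> comps G X \<Longrightarrow> C \<subseteq> verts G - X"
proof -
  have "v \<in> verts G - X" if "(u, v) \<in> (adj_minus G X)\<^sup>*" "u \<in> verts G - X" for u v
    using that by (induction rule: rtrancl_induct) (auto simp: adj_minus_def)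
  then show "C \<in> comps G X \<Longrightarrow> C \<subseteq> verts G - X"
    unfolding comps_def by blast
qed

lemma empty_in_fin_vsets: "{} \<in> fin_vsets G"
  by (simp add: fin_vsets_def)

lemma topspace_theta:
  assumes "simple_graph G"
  shows "topspace (theta G) = Inl ` realization G (verts G) \<union> Inr ` ultra_limit G"
proof -
  let ?R = "realization G (verts G)" and ?L = "ultra_limit G"
  have top: "openin (complex_topology G) ?R"
    using topspace_complex_topology[OF assms] openin_topspace by metis
  have sub1: "A \<subseteq> ?R" if "openin (complex_topology G) A" for A
    using that topspace_complex_topology[OF assms] openin_subset by metis
  have sub2: "basic_open G ?L X \<C> \<subseteq> Inl ` ?R \<union> Inr ` ?L"
    if "X \<in> fin_vsets G" "\<C> \<subseteq> comps G X" for X \<C>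
    using that comps_subset[of _ G X] by (intro basic_open_subset) (auto simp: fin_vsets_def)
  have 3: "Inr v \<in> basic_open G ?L {} (comps G {})" if "v \<in> ?L" for v
  proof -
    have "ultrafilter_on (comps G {}) (v {})"
      using that empty_in_fin_vsets[of G] unfolding ultra_limit_def by (blast dest: PiE_mem)
    then have "comps G {} \<in> v {}" by (simp add: ultrafilter_on_def)
    with that show ?thesis by (simp add: basic_open_def)
  qed
  show ?thesis
  proof (rule antisym)
    show "topspace (theta G) \<subseteq> Inl ` ?R \<union> Inr ` ?L"
      unfolding theta_def topology_generated_by_topspace
    proof (rule Union_least)
      fix S assume "S \<in> {Inl ` A | A. openin (complex_topology G) A} \<union>
        {basic_open G ?L X \<C> | X \<C>. X \<in> fin_vsets G \<and> \<C> \<subseteq> comps G X}"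
      then show "S \<subseteq> Inl ` ?R \<union> Inr ` ?L"
      proof (elim UnE CollectE exE conjE)
        fix A assume "S = Inl ` A" "openin (complex_topology G) A"
        then show ?thesis using sub1[of A] by blast
      next
        fix X \<C> assume "S = basic_open G ?L X \<C>" "X \<in> fin_vsets G" "\<C> \<subseteq> comps G X"
        then show ?thesis using sub2[of X \<C>] by simp
      qed
    qed
    have "Inl ` ?R \<subseteq> topspace (theta G)"
      unfolding theta_def topology_generated_by_topspace
      by (rule Union_upper) (use top in blast)
    moreover have "Inr v \<in> topspace (theta G)" if "v \<in> ?L" for v
      unfolding theta_def topology_generated_by_topspace
      by (rule UnionI[OF _ 3[OF that]], rule UnI2, use empty_in_fin_vsets in blast)
    ultimately show "Inl ` ?R \<union> Inr ` ?L \<subseteq> topspace (theta G)" by blast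
  qed
qed

lemma topspace_crit_space:
  assumes "simple_graph G"
  shows "topspace (crit_space G) = Inl ` realization G (verts G) \<union> Inr ` crit_limit G"
proof -
  let ?R = "realization G (verts G)" and ?L = "crit_limit G"
  have top: "openin (complex_topology G) ?R"
    using topspace_complex_topology[OF assms] openin_topspace by metis
  have sub1: "A \<subseteq> ?R" if "openin (complex_topology G) A" for A
    using that topspace_complex_topology[OF assms] openin_subset by metis
  have sub2: "basic_open G ?L X \<C> \<subseteq> Inl ` ?R \<union> Inr ` ?L"
    if "X \<in> fin_vsets G" "\<C> \<subseteq> comps G X" for X \<C>
    using that comps_subset[of _ G X] by (intro basic_open_subset) (auto simp: fin_vsets_def)
  have 3: "\<C> \<subseteq> comps G X" if "cofin_subset \<C> (comps_with_nbhd G X Y)" for \<C> X Y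
    using that by (auto simp: cofin_subset_def comps_with_nbhd_def)
  have 4: "(\<exists>C\<in>comps G {}. Inr F \<in> basic_open G ?L {} {C}) \<or>
      (\<exists>Y\<in>crit G {}. \<exists>\<C>. cofin_subset \<C> (comps_with_nbhd G {} Y) \<and> Inr F \<in> basic_open G ?L {} \<C>)"
    if F: "F \<in> ?L" for F
  proof -
    have "F {} \<in> crit_filters G {}"
      using F empty_in_fin_vsets[of G] by (auto simp: crit_limit_def PiE_def Pi_def)
    then consider (p) C where "C \<in> comps G {}" "F {} = princ G {} C"
      | (c) Y where "Y \<in> crit G {}" "F {} = crit_filter G {} Y"
      unfolding crit_filters_def by blast
    then show ?thesis
    proof cases
      case p
      then have "{C} \<in> F {}" by (simp add: princ_def)
      then show ?thesis using p F by (auto simp: basic_open_def)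
    next
      case c
      let ?C = "comps_with_nbhd G {} Y"
      have cof: "cofin_subset ?C ?C" by (simp add: cofin_subset_def)
      then have "?C \<in> F {}"
        unfolding c(2) crit_filter_def by (auto simp: comps_with_nbhd_def)
      then have "Inr F \<in> basic_open G ?L {} ?C" using F by (auto simp: basic_open_def)
      then show ?thesis using c(1) cof by blast
    qed
  qed
  show ?thesis
  proof (rule antisym)
    show "topspace (crit_space G) \<subseteq> Inl ` ?R \<union> Inr ` ?L"
      unfolding crit_space_def topology_generated_by_topspace
    proof (rule Union_least)
      fix S assume "S \<in> {Inl ` A | A. openin (complex_topology G) A} \<union>
        {basic_open G ?L X {C} | X C. X \<in> fin_vsets G \<and> C \<in> comps G X} \<union>
        {basic_open G ?L X \<C> | X \<C> Y. X \<in> fin_vsets G \<and> Y \<in> crit G X \<and>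
           cofin_subset \<C> (comps_with_nbhd G X Y)}"
      then consider (1) A where "S = Inl ` A" "openin (complex_topology G) A"
        | (2) X \<C> where "S = basic_open G ?L X \<C>" "X \<in> fin_vsets G" "\<C> \<subseteq> comps G X"
        by (auto dest!: 3)
      then show "S \<subseteq> Inl ` ?R \<union> Inr ` ?L"
      proof cases
        case (1 A)
        then show ?thesis using sub1[of A] by blast
      next
        case (2 X \<C>)
        then show ?thesis using sub2[of X \<C>] by simp
      qed
    qed
    have "Inl ` ?R \<subseteq> topspace (crit_space G)"
      unfolding crit_space_def topology_generated_by_topspace
      by (rule Union_upper) (use top in blast)
    moreover have "Inr F \<in> topspace (crit_space G)" if "F \<in> ?L" for F
      using 4[OF that]
    proof (elim disjE bexE exE conjE)
      fix C assume "C \<in> comps G {}" and F: "Inr F \<in> basic_open G ?L {} {C}"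
      then show ?thesis
        unfolding crit_space_def topology_generated_by_topspace
        by - (rule UnionI[OF _ F], rule UnI1, rule UnI2, use empty_in_fin_vsets in blast)
    next
      fix Y \<C> assume "Y \<in> crit G {}" "cofin_subset \<C> (comps_with_nbhd G {} Y)"
        and F: "Inr F \<in> basic_open G ?L {} \<C>"
      then show ?thesis
        unfolding crit_space_def topology_generated_by_topspace
        by - (rule UnionI[OF _ F], rule UnI2, use empty_in_fin_vsets in blast)
    qed
    ultimately show "Inl ` ?R \<union> Inr ` ?L \<subseteq> topspace (crit_space G)" by blast
  qed
qed

end

theory Submission
  imports Defs
begin

text \<open>On the filters in \<open>\<F>\<^sub>X\<close> the bonding maps of \<open>\<F>\<close> are given by the same formula as those of
  \<open>\<U>\<close>, and every ultrafilter on \<open>\<C>\<^sub>X\<close> extends exactly one member of \<open>\<F>\<^sub>X\<close>: either it is principal,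
  or it contains exactly one of the finitely many classes \<open>\<C>\<^sub>X(Y)\<close> and hence all its cofinite subsets.
  So every \<open>U \<in> \<U>\<close> lies above exactly one \<open>F \<in> \<F>\<close>, and \<open>\<Psi>\<close> sends the class of \<open>U\<close> to \<open>F\<close>.
  The basic open sets of \<open>\<F>G\<close> pull back to basic open sets of \<open>\<theta>G\<close>. Conversely, if a saturated open
  set contains the whole class belonging to a critical set \<open>Y\<close>, i.e. all free ultrafilters on
  \<open>\<C>\<^sub>Y(Y)\<close>, then by compactness of the space of free ultrafilters it contains the basic open set of
  a cofinite subset of \<open>\<C>\<^sub>Y(Y)\<close>. Hence \<open>\<Psi> \<union> id\<close> is induced by a quotient map whose fibres are the
  classes of \<open>\<asymp>\<close>.\<close>

subsection \<open>Components\<close>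

text \<open>The obstacle is one of levels. An open set around a point \<open>v\<close> of a class
  yields a basic open set at some finite \<open>X\<close> that depends on \<open>v\<close>, whereas
  a neighbourhood in \<open>crit_space\<close> has to serve the whole class at a single level
  \<open>Y\<close>. Two facts make the levels comparable. A component with neighbourhood exactly
  \<open>Y\<close> that avoids a finite \<open>X\<close> remains a component, with the same
  neighbourhood, after \<open>X \<union> Y\<close> is deleted; and only finitely many components
  meet \<open>X\<close>. So cofinitely many of the components in question are common to all higher
  levels, and a basic set found at level \<open>X\<close> can be carried to
  \<open>X \<union> Y\<close> and from there back down to \<open>Y\<close>. The same two facts show
  that one critical filter in a family of \<open>crit_limit G\<close> fixes all its other members,
  which is why \<open>Psi_rep\<close> can be specified by the least non-principal level alone. The
  classes of components at \<open>X\<close> are finite in number because the neighbourhood of a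
  component of \<open>G - X\<close> is a subset of the finite set \<open>X\<close>.\<close>

lemma adj_minus_sym: "sym ((adj_minus G X)\<^sup>*)"
  by (rule sym_rtrancl) (auto simp: sym_def adj_minus_def insert_commute)

lemma comps_eq_reachable:
  assumes "C \<in> comps G X" "u \<in> C"
  shows "C = {v. (u, v) \<in> (adj_minus G X)\<^sup>*}"
proof -
  obtain w where w: "C = {v. (w, v) \<in> (adj_minus G X)\<^sup>*}"
    using assms(1) unfolding comps_def by blast
  then have wu: "(w, u) \<in> (adj_minus G X)\<^sup>*" using assms(2) by blast
  then have "(u, w) \<in> (adj_minus G X)\<^sup>*" by (rule symD[OF adj_minus_sym])
  then have "(w, v) \<in> (adj_minus G X)\<^sup>* \<longleftrightarrow> (u, v) \<in> (adj_minus G X)\<^sup>*" for v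
    using wu rtrancl_trans by metis
  then show ?thesis unfolding w by simp
qed

lemma comps_eqI: "\<lbrakk>C \<in> comps G X; D \<in> comps G X; x \<in> C; x \<in> D\<rbrakk> \<Longrightarrow> C = D"
  using comps_eq_reachable[of C G X x] comps_eq_reachable[of D G X x] by simp

lemma comps_cover: "x \<in> verts G - X \<Longrightarrow> \<exists>C\<in>comps G X. x \<in> C"
  unfolding comps_def by auto

lemma comps_nonempty: "C \<in> comps G X \<Longrightarrow> C \<noteq> {}"
  unfolding comps_def by auto

lemma comps_superset_unique:
  assumes "C \<noteq> {}" "C \<subseteq> D" "C \<subseteq> E" "D \<in> comps G X" "E \<in> comps G X"
  shows "D = E"
  using assms comps_eqI[of D G X E] by blast

lemma comps_edge:
  assumes "C \<in> comps G X" "u \<in> C" "{u, v} \<in> edges G" "v \<in> verts G - X"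
  shows "v \<in> C"
proof -
  have "(u, v) \<in> adj_minus G X"
    using assms comps_subset[OF assms(1)] by (auto simp: adj_minus_def)
  then show ?thesis
    using comps_eq_reachable[OF assms(1,2)] by auto
qed

lemma nbhd_comp_subset: "C \<in> comps G X \<Longrightarrow> nbhd G C \<subseteq> X"
proof
  fix x assume C: "C \<in> comps G X" and "x \<in> nbhd G C"
  then obtain c where "c \<in> C" "{c, x} \<in> edges G" "x \<in> verts G" "x \<notin> C"
    by (auto simp: nbhd_def insert_commute)
  then show "x \<in> X" using comps_edge[OF C] by blast
qed

text \<open>A path inside \<open>C\<close> avoids \<open>X\<close> and so survives in
  \<open>G - X\<close>. The sets \<open>X\<close> and \<open>X'\<close> are left unrelated because a
  component of \<open>G - Y\<close> is later traced to arbitrary finite \<open>X\<close>.\<close>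

lemma comp_within_comp:
  assumes C: "C \<in> comps G X'" and disj: "C \<inter> X = {}"
  shows "\<exists>D\<in>comps G X. C \<subseteq> D"
proof -
  obtain u where u: "u \<in> C" using comps_nonempty[OF C] by blast
  have "(u, v) \<in> (adj_minus G X)\<^sup>*" if "(u, v) \<in> (adj_minus G X')\<^sup>*" for v
    using that
  proof (induction rule: rtrancl_induct)
    case (step v w)
    have "v \<in> C" "w \<in> C"
      using step(1,2) by (auto simp: comps_eq_reachable[OF C u])
    then have "(v, w) \<in> adj_minus G X"
      using step(2) disj by (auto simp: adj_minus_def)
    with step(3) show ?case by simp
  qed simp
  then have "C \<subseteq> {v. (u, v) \<in> (adj_minus G X)\<^sup>*}"
    using comps_eq_reachable[OF C u] by blast
  moreover have "u \<in> verts G - X"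
    using u comps_subset[OF C] disj by blast
  ultimately show ?thesis unfolding comps_def by blast
qed

text \<open>A path of \<open>G - X'\<close> that starts in \<open>C\<close> could leave
  \<open>C\<close> only through a vertex of \<open>nbhd G C\<close>, and these are all
  deleted.\<close>

lemma comp_transfer:
  assumes C: "C \<in> comps G X" and disj: "C \<inter> X' = {}" and nb: "nbhd G C \<subseteq> X'"
  shows "C \<in> comps G X'"
proof -
  obtain D where D: "D \<in> comps G X'" "C \<subseteq> D"
    using comp_within_comp[OF C disj] by blast
  obtain u where u: "u \<in> C" using comps_nonempty[OF C] by blast
  have "v \<in> C" if "(u, v) \<in> (adj_minus G X')\<^sup>*" for v
    using that
  proof (induction rule: rtrancl_induct)
    case (step v w)
    have "{w, v} \<in> edges G" "w \<in> verts G" "w \<notin> X'"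
      using step(2) by (auto simp: adj_minus_def insert_commute)
    then show ?case
      using nb step(3) unfolding nbhd_def by blast
  qed (rule u)
  then have "D \<subseteq> C"
    using comps_eq_reachable[OF D(1) subsetD[OF D(2) u]] by blast
  then show ?thesis using D by auto
qed

text \<open>Each vertex of \<open>Z\<close> determines the component containing it. Every later
  claim that something holds for cofinitely many components goes back to this.\<close>

lemma finite_comps_meeting:
  assumes "finite Z"
  shows "finite {C \<in> comps G X. C \<inter> Z \<noteq> {}}"
proof -
  have "{C \<in> comps G X. C \<inter> Z \<noteq> {}} \<subseteq> (\<lambda>z. {v. (z, v) \<in> (adj_minus G X)\<^sup>*}) ` Z"
  proof
    fix C assume "C \<in> {C \<in> comps G X. C \<inter> Z \<noteq> {}}"
    then obtain z where "C \<in> comps G X" "z \<in> C" "z \<in> Z" by blast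
    then show "C \<in> (\<lambda>z. {v. (z, v) \<in> (adj_minus G X)\<^sup>*}) ` Z"
      using comps_eq_reachable[of C G X z] by (intro image_eqI[of _ _ z])
  qed
  then show ?thesis using assms finite_surj by blast
qed

section \<open>The map from components to the larger components containing them\<close>

lemma comp_map_eq:
  assumes "C' \<in> comps G X'" "C \<in> comps G X" "C' \<subseteq> C"
  shows "comp_map G X' X C' = C"
  unfolding comp_map_def
proof (rule the_equality)
  fix D assume "D \<in> comps G X \<and> C' \<subseteq> D"
  then show "D = C"
    using comps_superset_unique[OF comps_nonempty[OF assms(1)] _ assms(3) _ assms(2)] by blast
qed (use assms in simp)

lemma comp_map:
  assumes "C' \<in> comps G X'" "X \<subseteq> X'"
  shows "comp_map G X' X C' \<in> comps G X" and "C' \<subseteq> comp_map G X' X C'"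
proof -
  have "C' \<inter> X = {}" using assms comps_subset[OF assms(1)] by blast
  then obtain D where "D \<in> comps G X" "C' \<subseteq> D"
    using comp_within_comp[OF assms(1)] by blast
  then show "comp_map G X' X C' \<in> comps G X" "C' \<subseteq> comp_map G X' X C'"
    by (simp_all add: comp_map_eq[OF assms(1)])
qed

section \<open>Components with a prescribed neighbourhood\<close>

lemma comps_with_nbhd_subset_comps: "comps_with_nbhd G X Y \<subseteq> comps G X"
  by (auto simp: comps_with_nbhd_def)

lemma comps_with_nbhd_transfer:
  assumes "C \<in> comps_with_nbhd G X Y" "Y \<subseteq> X'" "C \<inter> X' = {}"
  shows "C \<in> comps_with_nbhd G X' Y"
  using assms comp_transfer[of C G X X'] by (auto simp: comps_with_nbhd_def)

lemma comps_with_nbhd_antimono: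
  assumes "Y \<subseteq> X" "X \<subseteq> X'"
  shows "comps_with_nbhd G X' Y \<subseteq> comps_with_nbhd G X Y"
proof
  fix C assume C: "C \<in> comps_with_nbhd G X' Y"
  then have "C \<inter> X = {}"
    using assms(2) comps_subset[of C G X'] by (auto simp: comps_with_nbhd_def)
  then show "C \<in> comps_with_nbhd G X Y"
    using comps_with_nbhd_transfer[OF C assms(1)] by blast
qed

text \<open>The members lost on passing to \<open>X'\<close> must meet \<open>X'\<close>, since
  those avoiding it are transferred.\<close>

lemma finite_comps_with_nbhd_diff:
  assumes "finite X'" "Y \<subseteq> X'"
  shows "finite (comps_with_nbhd G X Y - comps_with_nbhd G X' Y)"
proof -
  have "comps_with_nbhd G X Y - comps_with_nbhd G X' Y \<subseteq> {C \<in> comps G X. C \<inter> X' \<noteq> {}}"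
    using comps_with_nbhd_transfer[OF _ assms(2)] comps_with_nbhd_subset_comps by blast
  then show ?thesis using finite_comps_meeting[OF assms(1)] finite_subset by blast
qed

lemma comps_with_nbhd_disjoint: "Y \<noteq> Z \<Longrightarrow> comps_with_nbhd G X Y \<inter> comps_with_nbhd G X Z = {}"
  by (auto simp: comps_with_nbhd_def)

text \<open>Being critical is a property of \<open>Y\<close> alone: a change of the ambient finite
  set loses only finitely many of infinitely many components.\<close>

lemma crit_change:
  assumes "Y \<in> crit G X" "finite X'" "Y \<subseteq> X'"
  shows "Y \<in> crit G X'"
proof -
  have "infinite (comps_with_nbhd G X' Y)"
    using finite_comps_with_nbhd_diff[OF assms(2,3), of G X] assms(1)
    by (auto simp: crit_def)
  then show ?thesis using assms(3) by (simp add: crit_def)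
qed

text \<open>Some \<open>y \<in> Y\<close> lies outside \<open>X\<close>. All the components are
  adjacent to \<open>y\<close>, so once \<open>y\<close> is put back they are joined inside the
  component of \<open>y\<close> in \<open>G - X\<close>. This is the second branch in the bonding
  maps of \<open>crit_limit\<close>.\<close>

lemma comps_with_nbhd_collapse:
  assumes "X \<subseteq> X'" "\<not> Y \<subseteq> X" "comps_with_nbhd G X' Y \<noteq> {}"
  obtains D where "D \<in> comps G X" "\<And>C. C \<in> comps_with_nbhd G X' Y \<Longrightarrow> C \<subseteq> D"
proof -
  obtain y where y: "y \<in> Y" "y \<notin> X" using assms(2) by blast
  obtain C where "nbhd G C = Y" using assms(3) unfolding comps_with_nbhd_def by blast
  then have yV: "y \<in> verts G - X" using y unfolding nbhd_def by blast
  obtain D where D: "D \<in> comps G X" "y \<in> D" using comps_cover[OF yV] by blast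
  have "C \<subseteq> D" if "C \<in> comps_with_nbhd G X' Y" for C
  proof -
    have C: "C \<in> comps G X'" and "nbhd G C = Y"
      using that by (auto simp: comps_with_nbhd_def)
    then have "y \<in> {x \<in> verts G - C. \<exists>c\<in>C. {x, c} \<in> edges G}" using y(1) by (simp add: nbhd_def)
    then obtain c where c: "c \<in> C" and "{y, c} \<in> edges G" by blast
    then have cy: "{c, y} \<in> edges G" by (simp add: insert_commute)
    let ?D = "comp_map G X' X C"
    have "y \<in> ?D"
      using comps_edge[OF comp_map(1)[OF C assms(1)] subsetD[OF comp_map(2)[OF C assms(1)] c] cy yV] .
    then have "?D = D" using comps_eqI[OF comp_map(1)[OF C assms(1)] D(1)] D(2) by simp
    then show ?thesis using comp_map(2)[OF C assms(1)] by blast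
  qed
  then show thesis using that D(1) by blast
qed

lemma comps_eq_Union_nbhd: "comps G X = (\<Union>Y\<in>Pow X. comps_with_nbhd G X Y)"
  using nbhd_comp_subset[of _ G X] unfolding comps_with_nbhd_def by blast

subsection \<open>Ultrafilters\<close>

lemma ultrafilter_onD:
  assumes "ultrafilter_on S U"
  shows "A \<in> U \<Longrightarrow> A \<subseteq> S" "S \<in> U" "{} \<notin> U"
    "A \<in> U \<Longrightarrow> B \<in> U \<Longrightarrow> A \<inter> B \<in> U"
    "A \<in> U \<Longrightarrow> A \<subseteq> B \<Longrightarrow> B \<subseteq> S \<Longrightarrow> B \<in> U"
    "A \<subseteq> S \<Longrightarrow> A \<notin> U \<Longrightarrow> S - A \<in> U"
proof -
  show "A \<in> U \<Longrightarrow> A \<subseteq> S" "S \<in> U" "{} \<notin> U"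
    "A \<in> U \<Longrightarrow> B \<in> U \<Longrightarrow> A \<inter> B \<in> U"
    using assms unfolding ultrafilter_on_def by auto
  show "A \<in> U \<Longrightarrow> A \<subseteq> B \<Longrightarrow> B \<subseteq> S \<Longrightarrow> B \<in> U"
    using assms unfolding ultrafilter_on_def by metis
  show "A \<subseteq> S \<Longrightarrow> A \<notin> U \<Longrightarrow> S - A \<in> U"
    using assms unfolding ultrafilter_on_def by metis
qed

lemma ultrafilter_on_Un:
  assumes U: "ultrafilter_on S U" and AB: "A \<union> B \<in> U"
  shows "A \<in> U \<or> B \<in> U"
proof (rule ccontr)
  assume not: "\<not> (A \<in> U \<or> B \<in> U)"
  have "A \<subseteq> S" "B \<subseteq> S" using ultrafilter_onD(1)[OF U AB] by auto
  then have "(S - A) \<inter> (S - B) \<in> U" using not ultrafilter_onD(4,6)[OF U] by blast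
  then have "(S - A) \<inter> (S - B) \<inter> (A \<union> B) \<in> U" using AB ultrafilter_onD(4)[OF U] by blast
  moreover have "(S - A) \<inter> (S - B) \<inter> (A \<union> B) = {}" by blast
  ultimately show False using ultrafilter_onD(3)[OF U] by simp
qed

lemma ultrafilter_on_finite_UN:
  assumes "ultrafilter_on S U" "finite I" "(\<Union>i\<in>I. A i) \<in> U"
  shows "\<exists>i\<in>I. A i \<in> U"
  using assms(2,3)
proof (induction I rule: finite_induct)
  case empty
  then show ?case using ultrafilter_onD(3)[OF assms(1)] by simp
next
  case (insert i I)
  then show ?case using ultrafilter_on_Un[OF assms(1), of "A i" "\<Union>(A ` I)"] by auto
qed

text \<open>The ultrafilter is the complement of a maximal proper ideal on \<open>S\<close> above
  \<open>J\<close>. The ideal form suits the applications, where the small sets are what is given;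
  as \<open>J\<close> may contain sets outside \<open>S\<close>, Zorn's lemma is started from
  \<open>J \<inter> Pow S\<close>.\<close>

lemma ultrafilter_avoiding_ideal:
  assumes down: "\<And>A B. A \<in> J \<Longrightarrow> B \<subseteq> A \<Longrightarrow> B \<in> J"
    and un: "\<And>A B. A \<in> J \<Longrightarrow> B \<in> J \<Longrightarrow> A \<union> B \<in> J"
    and ne: "{} \<in> J" and proper: "S \<notin> J"
  obtains W where "ultrafilter_on S W" "W \<inter> J = {}"
proof -
  define \<I> where "\<I> = {K. J \<inter> Pow S \<subseteq> K \<and> K \<subseteq> Pow S \<and> S \<notin> K \<and>
    (\<forall>A\<in>K. \<forall>B\<subseteq>A. B \<in> K) \<and> (\<forall>A\<in>K. \<forall>B\<in>K. A \<union> B \<in> K)}"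
  have idealI: "K \<in> \<I>" if "J \<inter> Pow S \<subseteq> K" "K \<subseteq> Pow S" "S \<notin> K"
      "\<And>A B. A \<in> K \<Longrightarrow> B \<subseteq> A \<Longrightarrow> B \<in> K" "\<And>A B. A \<in> K \<Longrightarrow> B \<in> K \<Longrightarrow> A \<union> B \<in> K" for K
    unfolding \<I>_def using that by simp
  have J: "J \<inter> Pow S \<in> \<I>"
    by (rule idealI) (use proper un down in auto)
  have "\<exists>M\<in>\<I>. \<forall>K\<in>\<I>. M \<subseteq> K \<longrightarrow> K = M"
  proof (rule subset_Zorn_nonempty)
    fix \<C> assume "\<C> \<noteq> {}" and chain: "subset.chain \<I> \<C>"
    then have sub: "\<C> \<subseteq> \<I>" and tot: "\<And>K L. K \<in> \<C> \<Longrightarrow> L \<in> \<C> \<Longrightarrow> K \<subseteq> L \<or> L \<subseteq> K"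
      by (auto simp: subset_chain_def)
    have mem: "J \<inter> Pow S \<subseteq> K" "K \<subseteq> Pow S" "S \<notin> K"
      "\<And>A B. A \<in> K \<Longrightarrow> B \<subseteq> A \<Longrightarrow> B \<in> K" "\<And>A B. A \<in> K \<Longrightarrow> B \<in> K \<Longrightarrow> A \<union> B \<in> K"
      if "K \<in> \<C>" for K
      using subsetD[OF sub that] unfolding \<I>_def by simp_all
    show "\<Union>\<C> \<in> \<I>"
    proof (rule idealI)
      show "J \<inter> Pow S \<subseteq> \<Union>\<C>" using mem(1) \<open>\<C> \<noteq> {}\<close> by blast
      show "\<Union>\<C> \<subseteq> Pow S" using mem(2) by blast
      show "S \<notin> \<Union>\<C>" using mem(3) by blast
    next
      fix A B assume A: "A \<in> \<Union>\<C>"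
      then obtain K where K: "K \<in> \<C>" "A \<in> K" by blast
      show "B \<in> \<Union>\<C>" if "B \<subseteq> A" using mem(4)[OF K that] K(1) by blast
      assume "B \<in> \<Union>\<C>"
      then obtain L where L: "L \<in> \<C>" "B \<in> L" by blast
      obtain M where M: "M \<in> \<C>" "A \<in> M" "B \<in> M"
        using tot[OF K(1) L(1)] K L by blast
      then show "A \<union> B \<in> \<Union>\<C>" using mem(5)[OF M] by blast
    qed
  qed (use J in blast)
  then obtain M where M: "M \<in> \<I>" and max: "\<And>K. K \<in> \<I> \<Longrightarrow> M \<subseteq> K \<Longrightarrow> K = M" by blast
  have MJ: "J \<inter> Pow S \<subseteq> M" and MS: "M \<subseteq> Pow S" and SM: "S \<notin> M"
    and Mdown: "\<And>A B. A \<in> M \<Longrightarrow> B \<subseteq> A \<Longrightarrow> B \<in> M"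
    and Mun: "\<And>A B. A \<in> M \<Longrightarrow> B \<in> M \<Longrightarrow> A \<union> B \<in> M"
    using M unfolding \<I>_def by simp_all
  have prime: "A \<in> M \<or> S - A \<in> M" if A: "A \<subseteq> S" for A
  proof (rule ccontr)
    assume not: "\<not> (A \<in> M \<or> S - A \<in> M)"
    \<comment> \<open>The ideal generated by \<open>M\<close> and \<open>A\<close>. It is proper
      because otherwise \<open>S - A\<close> would lie in \<open>M\<close>; maximality then puts
      \<open>A\<close> into \<open>M\<close>.\<close>
    define K where "K = {B. B \<subseteq> S \<and> (\<exists>N\<in>M. B \<subseteq> N \<union> A)}"
    have "S \<notin> K"
    proof
      assume "S \<in> K"
      then obtain N where "N \<in> M" "S \<subseteq> N \<union> A" unfolding K_def by blast
      then have "S - A \<in> M" using Mdown[of N "S - A"] by blast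
      then show False using not by blast
    qed
    moreover have "B \<union> C \<in> K" if BC: "B \<in> K" "C \<in> K" for B C
    proof -
      obtain N N' where "N \<in> M" "N' \<in> M" "B \<subseteq> N \<union> A" "C \<subseteq> N' \<union> A"
        using BC unfolding K_def by blast
      then have "N \<union> N' \<in> M" "B \<union> C \<subseteq> (N \<union> N') \<union> A" using Mun by blast+
      then show ?thesis using BC unfolding K_def by blast
    qed
    moreover have MK: "M \<subseteq> K" using MS unfolding K_def by blast
    moreover have "K \<subseteq> Pow S" "\<And>B C. B \<in> K \<Longrightarrow> C \<subseteq> B \<Longrightarrow> C \<in> K" unfolding K_def by blast+
    ultimately have "K \<in> \<I>" using MJ by (intro idealI) blast+
    then have "K = M" using max MK by blast
    moreover have "{} \<in> M" using MJ ne by blast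
    then have "A \<in> K" unfolding K_def using A by blast
    ultimately show False using not by blast
  qed
  have "ultrafilter_on S (Pow S - M)"
    unfolding ultrafilter_on_def
  proof (intro conjI ballI allI impI)
    show "{} \<notin> Pow S - M" using MJ ne by blast
    fix A B assume A: "A \<in> Pow S - M"
    show "A \<inter> B \<in> Pow S - M" if "B \<in> Pow S - M"
    proof -
      have "S - A \<in> M" "S - B \<in> M" using prime A that by blast+
      then have "(S - A) \<union> (S - B) \<in> M" by (rule Mun)
      moreover have "(S - A) \<union> (S - B) \<union> (A \<inter> B) = S" using A that by blast
      ultimately have "A \<inter> B \<notin> M" using Mun SM by metis
      then show ?thesis using A by blast
    qed
    show "B \<in> Pow S - M" if "A \<subseteq> B \<and> B \<subseteq> S" using A that Mdown by blast
  next
    fix A assume A: "A \<subseteq> S"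
    have "A \<notin> M \<or> S - A \<notin> M"
      using Mun[of A "S - A"] SM A by (auto simp: Un_absorb1)
    then show "A \<in> Pow S - M \<or> S - A \<in> Pow S - M" using A by blast
  qed (use SM in auto)
  then show thesis using that MJ by blast
qed

subsection \<open>Filters on sets of components\<close>

lemma mem_princ: "A \<in> princ G X C \<longleftrightarrow> A \<subseteq> comps G X \<and> C \<in> A"
  by (simp add: princ_def)

lemma mem_crit_filter:
  "A \<in> crit_filter G X Y \<longleftrightarrow> A \<subseteq> comps G X \<and> finite (comps_with_nbhd G X Y - A)"
proof
  assume "A \<in> crit_filter G X Y"
  then obtain B where B: "A \<subseteq> comps G X" "B \<subseteq> A" "finite (comps_with_nbhd G X Y - B)"
    unfolding crit_filter_def cofin_subset_def by blast
  then have "comps_with_nbhd G X Y - A \<subseteq> comps_with_nbhd G X Y - B" by blast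
  then show "A \<subseteq> comps G X \<and> finite (comps_with_nbhd G X Y - A)"
    using B finite_subset by blast
next
  assume A: "A \<subseteq> comps G X \<and> finite (comps_with_nbhd G X Y - A)"
  have "comps_with_nbhd G X Y - A \<inter> comps_with_nbhd G X Y = comps_with_nbhd G X Y - A" by blast
  then have "cofin_subset (A \<inter> comps_with_nbhd G X Y) (comps_with_nbhd G X Y)"
    using A by (simp add: cofin_subset_def)
  then show "A \<in> crit_filter G X Y"
    using A unfolding crit_filter_def by blast
qed

lemma mem_ultra_map:
  "A \<in> ultra_map G X' X F \<longleftrightarrow> A \<subseteq> comps G X \<and> (\<exists>A'\<in>F. comp_map G X' X ` A' \<subseteq> A)"
  by (simp add: ultra_map_def)

lemma ultra_map_mono: "F \<subseteq> F' \<Longrightarrow> ultra_map G X' X F \<subseteq> ultra_map G X' X F'"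
  unfolding ultra_map_def by blast

lemma princ_inj:
  assumes "C \<in> comps G X" "princ G X C = princ G X D"
  shows "C = D"
proof -
  have "{C} \<in> princ G X D" using assms by (simp add: mem_princ flip: assms(2))
  then show ?thesis by (simp add: mem_princ)
qed

text \<open>The complement of a finite set omits only finitely many members of the class, so it lies
  in the critical filter; hence the ultrafilter is free.\<close>

lemma crit_filter_subset_ultrafilter:
  assumes U: "ultrafilter_on (comps G X) U" and sub: "crit_filter G X Y \<subseteq> U"
  shows "comps_with_nbhd G X Y \<in> U" and "A \<subseteq> comps G X \<Longrightarrow> finite A \<Longrightarrow> A \<notin> U"
proof -
  show "comps_with_nbhd G X Y \<in> U"
    using sub comps_with_nbhd_subset_comps[of G X Y] by (auto simp: mem_crit_filter)
  assume A: "A \<subseteq> comps G X" "finite A"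
  have "comps_with_nbhd G X Y - (comps G X - A) \<subseteq> A"
    using comps_with_nbhd_subset_comps[of G X Y] by blast
  then have "comps G X - A \<in> crit_filter G X Y"
    using A(2) finite_subset by (auto simp: mem_crit_filter)
  then have "comps G X - A \<in> U" using sub by blast
  moreover have "A \<inter> (comps G X - A) = {}" by blast
  ultimately show "A \<notin> U"
    using ultrafilter_onD(3)[OF U] ultrafilter_onD(4)[OF U, of A] by metis
qed

lemma crit_filter_not_princ:
  assumes "Y \<in> crit G X"
  shows "\<not> is_princ G X (crit_filter G X Y)"
proof
  assume "is_princ G X (crit_filter G X Y)"
  then obtain C where C: "C \<in> comps G X" "crit_filter G X Y = princ G X C"
    unfolding is_princ_def by blast
  then have "{C} \<in> crit_filter G X Y" by (simp add: mem_princ)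
  then have "finite (comps_with_nbhd G X Y - {C})" by (simp add: mem_crit_filter)
  then show False using assms by (simp add: crit_def)
qed

lemma crit_filter_inj:
  assumes "Y \<in> crit G X" "crit_filter G X Y = crit_filter G X Z"
  shows "Y = Z"
proof (rule ccontr)
  assume "Y \<noteq> Z"
  have "comps_with_nbhd G X Z \<in> crit_filter G X Y"
    unfolding assms(2) using comps_with_nbhd_subset_comps[of G X Z] by (simp add: mem_crit_filter)
  then have "finite (comps_with_nbhd G X Y - comps_with_nbhd G X Z)" by (simp add: mem_crit_filter)
  moreover have "comps_with_nbhd G X Y - comps_with_nbhd G X Z = comps_with_nbhd G X Y"
    using comps_with_nbhd_disjoint[OF \<open>Y \<noteq> Z\<close>] by blast
  ultimately show False using assms(1) by (simp add: crit_def)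
qed

section \<open>Bonding maps on principal and critical filters\<close>

lemma ultra_map_princ:
  assumes "X \<subseteq> X'" "C \<in> comps G X'"
  shows "ultra_map G X' X (princ G X' C) = princ G X (comp_map G X' X C)"
proof (intro set_eqI iffI)
  fix A assume "A \<in> princ G X (comp_map G X' X C)"
  then have "A \<subseteq> comps G X" "comp_map G X' X ` {C} \<subseteq> A" "{C} \<in> princ G X' C"
    using assms(2) by (auto simp: mem_princ)
  then show "A \<in> ultra_map G X' X (princ G X' C)" unfolding mem_ultra_map by blast
qed (auto simp: mem_princ mem_ultra_map)

lemma comp_map_id:
  assumes "Y \<subseteq> X" "X \<subseteq> X'" "C \<in> comps_with_nbhd G X' Y"
  shows "comp_map G X' X C = C"
proof (rule comp_map_eq)
  show "C \<in> comps G X'" using assms(3) comps_with_nbhd_subset_comps by blast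
  have "C \<in> comps_with_nbhd G X Y" using comps_with_nbhd_antimono[OF assms(1,2)] assms(3) by blast
  then show "C \<in> comps G X" using comps_with_nbhd_subset_comps by blast
qed simp

text \<open>The class at \<open>X'\<close> is a cofinite part of the class at \<open>X\<close>, and
  \<open>comp_map\<close> fixes each of its members.\<close>

lemma ultra_map_crit_filter:
  assumes "Y \<subseteq> X" "X \<subseteq> X'" "finite X'"
  shows "ultra_map G X' X (crit_filter G X' Y) = crit_filter G X Y"
proof (intro set_eqI iffI)
  let ?S = "comps_with_nbhd G X Y" and ?S' = "comps_with_nbhd G X' Y"
  have SS: "?S' \<subseteq> ?S" "finite (?S - ?S')"
    using comps_with_nbhd_antimono[OF assms(1,2)] finite_comps_with_nbhd_diff[of X' Y] assms by auto
  fix A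
  show "A \<in> crit_filter G X Y" if A: "A \<in> ultra_map G X' X (crit_filter G X' Y)"
  proof -
    obtain A' where A': "A' \<in> crit_filter G X' Y" "comp_map G X' X ` A' \<subseteq> A"
      using A unfolding mem_ultra_map by blast
    have "C \<in> A" if "C \<in> A'" "C \<in> ?S'" for C
      using A'(2) comp_map_id[OF assms(1,2) that(2)] that(1) by force
    then have "?S - A \<subseteq> (?S - ?S') \<union> (?S' - A')" by blast
    then have "finite (?S - A)"
      using SS(2) A'(1) by (simp add: mem_crit_filter finite_subset)
    then show ?thesis using A by (simp add: mem_crit_filter mem_ultra_map)
  qed
  show "A \<in> ultra_map G X' X (crit_filter G X' Y)" if A: "A \<in> crit_filter G X Y"
  proof -
    have "?S' - (A \<inter> ?S') \<subseteq> ?S - A" using SS(1) by blast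
    then have "A \<inter> ?S' \<in> crit_filter G X' Y"
      using A finite_subset comps_with_nbhd_subset_comps[of G X' Y] by (auto simp: mem_crit_filter)
    moreover have "comp_map G X' X ` (A \<inter> ?S') \<subseteq> A"
      by (auto simp: comp_map_id[OF assms(1,2)])
    moreover have "A \<subseteq> comps G X" using A by (simp add: mem_crit_filter)
    ultimately show ?thesis unfolding mem_ultra_map by (intro conjI bexI[of _ "A \<inter> ?S'"])
  qed
qed

text \<open>On the whole class \<open>comp_map\<close> is constant with value \<open>D\<close>, and
  every set in the critical filter meets the class because the class is infinite.\<close>

lemma ultra_map_crit_filter_collapse:
  assumes "X \<subseteq> X'" "Y \<in> crit G X'" "D \<in> comps G X"
    and D: "\<And>C. C \<in> comps_with_nbhd G X' Y \<Longrightarrow> C \<subseteq> D"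
  shows "ultra_map G X' X (crit_filter G X' Y) = princ G X D"
proof (intro set_eqI iffI)
  let ?S' = "comps_with_nbhd G X' Y"
  have map: "comp_map G X' X C = D" if "C \<in> ?S'" for C
    using comp_map_eq[OF _ assms(3) D[OF that]] that comps_with_nbhd_subset_comps by blast
  fix A
  show "A \<in> princ G X D" if A: "A \<in> ultra_map G X' X (crit_filter G X' Y)"
  proof -
    obtain A' where A': "A' \<in> crit_filter G X' Y" "comp_map G X' X ` A' \<subseteq> A"
      using A unfolding mem_ultra_map by blast
    have "\<not> ?S' \<subseteq> ?S' - A'"
      using A'(1) assms(2) finite_subset by (auto simp: mem_crit_filter crit_def)
    then obtain C where "C \<in> A'" "C \<in> ?S'" by blast
    then have "D \<in> A" using A'(2) map by blast
    then show ?thesis using A by (simp add: mem_princ mem_ultra_map)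
  qed
  show "A \<in> ultra_map G X' X (crit_filter G X' Y)" if A: "A \<in> princ G X D"
  proof -
    have "?S' \<in> crit_filter G X' Y"
      using comps_with_nbhd_subset_comps[of G X' Y] by (simp add: mem_crit_filter)
    moreover have "comp_map G X' X ` ?S' \<subseteq> A" using map A by (auto simp: mem_princ)
    ultimately show ?thesis using A unfolding mem_ultra_map mem_princ by blast
  qed
qed

lemma crit_filters_cases:
  assumes "F \<in> crit_filters G X"
  obtains (princ) C where "C \<in> comps G X" "F = princ G X C"
  | (crit) Y where "Y \<in> crit G X" "F = crit_filter G X Y"
  using assms unfolding crit_filters_def by blast

lemma crit_collapse:
  assumes "X \<subseteq> X'" "\<not> Y \<subseteq> X" "Y \<in> crit G X'"
  obtains D where "D \<in> comps G X" "\<And>C. C \<in> comps_with_nbhd G X' Y \<Longrightarrow> C \<subseteq> D"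
proof -
  have "comps_with_nbhd G X' Y \<noteq> {}" using assms(3) by (auto simp: crit_def)
  then show thesis using comps_with_nbhd_collapse[OF assms(1,2)] that by blast
qed

text \<open>The work lies in showing that the description in \<open>crit_map\<close> is unambiguous:
  principal and critical filters differ, a critical filter determines its \<open>Y\<close>, and the
  component \<open>C\<close> is determined because the union it must contain is nonempty. The gain
  is that the bonding maps become monotone in the filter, so they can be compared with those on
  ultrafilters.\<close>

lemma crit_map_eq_ultra_map:
  assumes "X \<subseteq> X'" "finite X'" "F \<in> crit_filters G X'"
  shows "crit_map G X' X F = ultra_map G X' X F"
  using assms(3)
proof (cases rule: crit_filters_cases)
  case (princ C)
  have np: "princ G X' C \<noteq> crit_filter G X' Y" if "Y \<in> crit G X'" for Y
    using crit_filter_not_princ[OF that] princ(1) unfolding is_princ_def by metis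
  show ?thesis
    unfolding crit_map_def
  proof (rule the_equality, goal_cases)
    case 1
    then show ?case using princ ultra_map_princ[OF assms(1) princ(1)] by blast
  next
    case (2 F')
    then obtain C' where "F = princ G X' C'" "F' = princ G X (comp_map G X' X C')"
      using np princ(2) by blast
    then show ?case
      using princ_inj[OF princ(1)] princ(2) ultra_map_princ[OF assms(1) princ(1)] by metis
  qed
next
  case (crit Y)
  have np: "crit_filter G X' Y \<noteq> princ G X' C" if "C \<in> comps G X'" for C
    using crit_filter_not_princ[OF crit(1)] that unfolding is_princ_def by blast
  have inj: "Z = Y" if "F = crit_filter G X' Z" for Z
    using crit_filter_inj[OF crit(1)] that crit(2) by metis
  have ne: "\<Union> (comps_with_nbhd G X' Y) \<noteq> {}"
  proof -
    obtain C where C: "C \<in> comps_with_nbhd G X' Y"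
      using crit(1) unfolding crit_def by fastforce
    then have "C \<noteq> {}" using comps_nonempty comps_with_nbhd_subset_comps by blast
    then show ?thesis using C by blast
  qed
  show ?thesis
  proof (cases "Y \<subseteq> X")
    case True
    have eq: "ultra_map G X' X F = crit_filter G X Y"
      unfolding crit(2) by (rule ultra_map_crit_filter[OF True assms(1,2)])
    show ?thesis
      unfolding crit_map_def
    proof (rule the_equality, goal_cases)
      case 1
      show ?case using crit True eq by auto
    next
      case (2 F')
      then obtain Z where "F = crit_filter G X' Z"
          "if Z \<subseteq> X then F' = crit_filter G X Z
           else \<exists>C\<in>comps G X. \<Union> (comps_with_nbhd G X' Z) \<subseteq> C \<and> F' = princ G X C"
        using np crit(2) by blast
      then show ?case using inj[of Z] True eq by simp
    qed
  next
    case False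
    obtain D where D: "D \<in> comps G X" "\<And>C. C \<in> comps_with_nbhd G X' Y \<Longrightarrow> C \<subseteq> D"
      using crit_collapse[OF assms(1) False crit(1)] by blast
    have eq: "ultra_map G X' X F = princ G X D"
      unfolding crit(2) by (rule ultra_map_crit_filter_collapse[OF assms(1) crit(1) D])
    have UD: "\<Union> (comps_with_nbhd G X' Y) \<subseteq> D" using D(2) by blast
    show ?thesis
      unfolding crit_map_def
    proof (rule the_equality, goal_cases)
      case 1
      have "\<exists>C\<in>comps G X. \<Union> (comps_with_nbhd G X' Y) \<subseteq> C \<and> ultra_map G X' X F = princ G X C"
        using D(1) UD eq by blast
      then show ?case using crit False by (intro disjI2 bexI[of _ Y]) simp_all
    next
      case (2 F')
      then obtain Z where "F = crit_filter G X' Z"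
          "if Z \<subseteq> X then F' = crit_filter G X Z
           else \<exists>C\<in>comps G X. \<Union> (comps_with_nbhd G X' Z) \<subseteq> C \<and> F' = princ G X C"
        using np crit(2) by blast
      then have "\<exists>C\<in>comps G X. \<Union> (comps_with_nbhd G X' Y) \<subseteq> C \<and> F' = princ G X C"
        using inj[of Z] False by simp
      then obtain C where C: "C \<in> comps G X" "\<Union> (comps_with_nbhd G X' Y) \<subseteq> C" "F' = princ G X C"
        by blast
      then show ?case using comps_superset_unique[OF ne UD C(2) D(1) C(1)] eq by simp
    qed
  qed
qed

lemma ultra_map_crit_filters:
  assumes "X \<subseteq> X'" "finite X'" "F \<in> crit_filters G X'"
  shows "ultra_map G X' X F \<in> crit_filters G X"
  using assms(3)
proof (cases rule: crit_filters_cases)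
  case (princ C)
  then show ?thesis
    using ultra_map_princ[OF assms(1) princ(1)] comp_map(1)[OF princ(1) assms(1)]
    by (simp add: crit_filters_def)
next
  case (crit Y)
  show ?thesis
  proof (cases "Y \<subseteq> X")
    case True
    then have "Y \<in> crit G X"
      using crit_change[OF crit(1) _ True] finite_subset[OF assms(1,2)] by blast
    then show ?thesis
      unfolding crit(2) ultra_map_crit_filter[OF True assms(1,2)] by (simp add: crit_filters_def)
  next
    case False
    obtain D where D: "D \<in> comps G X" "\<And>C. C \<in> comps_with_nbhd G X' Y \<Longrightarrow> C \<subseteq> D"
      using crit_collapse[OF assms(1) False crit(1)] by blast
    have "ultra_map G X' X F = princ G X D"
      unfolding crit(2) by (rule ultra_map_crit_filter_collapse[OF assms(1) crit(1) D])
    then show ?thesis using D(1) by (simp add: crit_filters_def)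
  qed
qed

section \<open>Members of the two limits at a single level\<close>

lemma fin_vsets_finite: "X \<in> fin_vsets G \<Longrightarrow> finite X"
  by (simp add: fin_vsets_def)

lemma fin_vsets_Un: "X \<in> fin_vsets G \<Longrightarrow> X' \<in> fin_vsets G \<Longrightarrow> X \<union> X' \<in> fin_vsets G"
  by (simp add: fin_vsets_def)

lemma fin_vsets_subset: "X \<in> fin_vsets G \<Longrightarrow> Y \<subseteq> X \<Longrightarrow> Y \<in> fin_vsets G"
  by (auto simp: fin_vsets_def intro: finite_subset)

lemma mem_crit_limit:
  "F \<in> crit_limit G \<longleftrightarrow> F \<in> (\<Pi>\<^sub>E X\<in>fin_vsets G. crit_filters G X) \<and>
     (\<forall>X\<in>fin_vsets G. \<forall>X'\<in>fin_vsets G. X \<subseteq> X' \<longrightarrow> ultra_map G X' X (F X') = F X)"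
proof -
  have "crit_map G X' X (F X') = ultra_map G X' X (F X')"
    if "F \<in> (\<Pi>\<^sub>E X\<in>fin_vsets G. crit_filters G X)" "X' \<in> fin_vsets G" "X \<subseteq> X'" for X X'
    using crit_map_eq_ultra_map[OF that(3) fin_vsets_finite[OF that(2)] PiE_mem[OF that(1,2)]] .
  then show ?thesis unfolding crit_limit_def by auto
qed

lemma crit_limitD:
  assumes "F \<in> crit_limit G" "X \<in> fin_vsets G"
  shows "F X \<in> crit_filters G X" "X' \<in> fin_vsets G \<Longrightarrow> X \<subseteq> X' \<Longrightarrow> ultra_map G X' X (F X') = F X"
  using assms by (auto simp: mem_crit_limit dest: PiE_mem)

lemma ultra_limitD:
  assumes "U \<in> ultra_limit G" "X \<in> fin_vsets G"
  shows "ultrafilter_on (comps G X) (U X)"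
    "X' \<in> fin_vsets G \<Longrightarrow> X \<subseteq> X' \<Longrightarrow> ultra_map G X' X (U X') = U X"
  using assms by (auto simp: ultra_limit_def dest: PiE_mem)

section \<open>The principal or critical filter below an ultrafilter\<close>

lemma ultrafilter_on_princI:
  assumes "ultrafilter_on (comps G X) U" "{C} \<in> U"
  shows "U = princ G X C"
proof (intro set_eqI iffI)
  fix A assume A: "A \<in> U"
  then have "A \<inter> {C} \<noteq> {}"
    using ultrafilter_onD(3,4)[OF assms(1)] assms(2) by metis
  then show "A \<in> princ G X C" using ultrafilter_onD(1)[OF assms(1) A] by (simp add: mem_princ)
next
  fix A assume "A \<in> princ G X C"
  then show "A \<in> U" using ultrafilter_onD(5)[OF assms, of A] by (simp add: mem_princ)
qed

lemma nonprinc_ultrafilter_finite: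
  assumes U: "ultrafilter_on (comps G X) U" and np: "\<not> is_princ G X U" and "finite A"
  shows "A \<notin> U"
proof
  assume A: "A \<in> U"
  then have "(\<Union>C\<in>A. {C}) \<in> U" by simp
  then obtain C where C: "C \<in> A" "{C} \<in> U"
    using ultrafilter_on_finite_UN[OF U \<open>finite A\<close>] by blast
  then have "C \<in> comps G X" using ultrafilter_onD(1)[OF U A] by blast
  then show False using np ultrafilter_on_princI[OF U C(2)] unfolding is_princ_def by blast
qed

lemma crit_filter_below_ultrafilter:
  assumes U: "ultrafilter_on (comps G X) U" and "finite X"
  obtains F where "F \<in> crit_filters G X" "F \<subseteq> U"
proof (cases "is_princ G X U")
  case True
  then have "U \<in> crit_filters G X" unfolding is_princ_def crit_filters_def by blast
  then show thesis using that by blast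
next
  case False
  have "(\<Union>Y\<in>Pow X. comps_with_nbhd G X Y) \<in> U"
    using ultrafilter_onD(2)[OF U] comps_eq_Union_nbhd by metis
  then obtain Y where Y: "Y \<subseteq> X" "comps_with_nbhd G X Y \<in> U"
    using ultrafilter_on_finite_UN[OF U] \<open>finite X\<close> by blast
  have "Y \<in> crit G X"
    using Y nonprinc_ultrafilter_finite[OF U False] unfolding crit_def by blast
  moreover have "crit_filter G X Y \<subseteq> U"
  proof
    \<comment> \<open>Only finitely many members of the class lie outside \<open>A\<close>, and
      \<open>U\<close> contains no finite set, so \<open>U\<close> must choose the part inside
      \<open>A\<close>.\<close>
    fix A assume A: "A \<in> crit_filter G X Y"
    then have "comps_with_nbhd G X Y - A \<notin> U"
      using nonprinc_ultrafilter_finite[OF U False] by (simp add: mem_crit_filter)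
    moreover have "(comps_with_nbhd G X Y - A) \<union> (comps_with_nbhd G X Y \<inter> A) \<in> U"
      using Y(2) by (simp add: Un_Diff_Int)
    ultimately have "comps_with_nbhd G X Y \<inter> A \<in> U"
      using ultrafilter_on_Un[OF U] by blast
    then show "A \<in> U" using ultrafilter_onD(5)[OF U] A by (auto simp: mem_crit_filter)
  qed
  ultimately show thesis using that unfolding crit_filters_def by blast
qed

lemma princ_below_ultrafilter:
  assumes "ultrafilter_on (comps G X) U" "C \<in> comps G X" "princ G X C \<subseteq> U"
  shows "U = princ G X C"
proof (rule ultrafilter_on_princI[OF assms(1)])
  have "{C} \<in> princ G X C" using assms(2) by (simp add: mem_princ)
  then show "{C} \<in> U" using assms(3) by blast
qed

text \<open>A critical filter forces \<open>U\<close> to be free, which excludes a principal filter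
  below it; two different classes are disjoint and cannot both belong to \<open>U\<close>.\<close>

lemma crit_filters_below_unique:
  assumes U: "ultrafilter_on (comps G X) U"
    and F: "F \<in> crit_filters G X" "F \<subseteq> U" and F': "F' \<in> crit_filters G X" "F' \<subseteq> U"
  shows "F = F'"
proof -
  have no: False if "C \<in> comps G X" "princ G X C \<subseteq> U" "crit_filter G X Y \<subseteq> U" for C Y
  proof -
    have "{C} \<in> princ G X C" using that(1) by (simp add: mem_princ)
    then show False
      using crit_filter_subset_ultrafilter(2)[OF U that(3), of "{C}"] that(1,2) by blast
  qed
  have cc: "Y = Z" if "crit_filter G X Y \<subseteq> U" "crit_filter G X Z \<subseteq> U" for Y Z
  proof (rule ccontr)
    assume "Y \<noteq> Z"
    then have "{} \<in> U"
      using ultrafilter_onD(4)[OF U crit_filter_subset_ultrafilter(1)[OF U that(1)]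
          crit_filter_subset_ultrafilter(1)[OF U that(2)]]
      by (simp add: comps_with_nbhd_disjoint)
    then show False using ultrafilter_onD(3)[OF U] by blast
  qed
  show ?thesis
    using F(1)
  proof (cases rule: crit_filters_cases)
    case (princ C)
    show ?thesis using F'(1)
    proof (cases rule: crit_filters_cases)
      case p: (princ D)
      then show ?thesis using princ princ_below_ultrafilter[OF U] F(2) F'(2) by metis
    next
      case (crit Y)
      then show ?thesis using no[of C Y] princ F(2) F'(2) by simp
    qed
  next
    case (crit Y)
    show ?thesis using F'(1)
    proof (cases rule: crit_filters_cases)
      case (princ D)
      then show ?thesis using no[of D Y] crit F(2) F'(2) by simp
    next
      case c: (crit Z)
      then show ?thesis using crit cc[of Y Z] F(2) F'(2) by simp
    qed
  qed
qed

text \<open>Through this, least non-principal levels are shared by a family of ultrafilters and the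
  family below it.\<close>

lemma is_princ_below_iff:
  assumes U: "ultrafilter_on (comps G X) U" and F: "F \<in> crit_filters G X" "F \<subseteq> U"
  shows "is_princ G X F \<longleftrightarrow> is_princ G X U"
proof
  assume "is_princ G X F"
  then show "is_princ G X U"
    using princ_below_ultrafilter[OF U] F(2) unfolding is_princ_def by metis
next
  assume "is_princ G X U"
  moreover from this have "U \<in> crit_filters G X" unfolding is_princ_def crit_filters_def by blast
  ultimately show "is_princ G X F" using crit_filters_below_unique[OF U F] by blast
qed

subsection \<open>The two inverse limits\<close>

text \<open>The filters are chosen level by level; compatibility is then automatic. The image of
  \<open>F X'\<close> lies below \<open>U X\<close> by monotonicity, and uniqueness identifies it
  with \<open>F X\<close>.\<close>

lemma family_below_exists:
  assumes U: "U \<in> ultra_limit G"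
  obtains F where "F \<in> crit_limit G" "\<And>X. X \<in> fin_vsets G \<Longrightarrow> F X \<subseteq> U X"
proof -
  have "\<exists>F. F \<in> crit_filters G X \<and> F \<subseteq> U X" if X: "X \<in> fin_vsets G" for X
    using crit_filter_below_ultrafilter[OF ultra_limitD(1)[OF U X] fin_vsets_finite[OF X]] by metis
  then obtain f where f: "\<And>X. X \<in> fin_vsets G \<Longrightarrow> f X \<in> crit_filters G X \<and> f X \<subseteq> U X"
    by metis
  define F where "F = restrict f (fin_vsets G)"
  have F: "F X \<in> crit_filters G X" "F X \<subseteq> U X" if "X \<in> fin_vsets G" for X
    using f[OF that] that by (simp_all add: F_def)
  have "ultra_map G X' X (F X') = F X"
    if X: "X \<in> fin_vsets G" and X': "X' \<in> fin_vsets G" and sub: "X \<subseteq> X'" for X X'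
  proof (rule crit_filters_below_unique[OF ultra_limitD(1)[OF U X] _ _ F[OF X]])
    show "ultra_map G X' X (F X') \<in> crit_filters G X"
      by (rule ultra_map_crit_filters[OF sub fin_vsets_finite[OF X'] F(1)[OF X']])
    show "ultra_map G X' X (F X') \<subseteq> U X"
      using ultra_map_mono[OF F(2)[OF X'], of G X' X] ultra_limitD(2)[OF U X X' sub] by simp
  qed
  moreover have "F \<in> (\<Pi>\<^sub>E X\<in>fin_vsets G. crit_filters G X)"
    unfolding F_def using f by (intro restrict_PiE_iff[THEN iffD2]) blast
  ultimately have "F \<in> crit_limit G" unfolding mem_crit_limit by blast
  then show thesis using that F(2) by blast
qed

lemma ends_subset_crit_limit: "ends G \<subseteq> crit_limit G"
proof
  fix U assume "U \<in> ends G"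
  then have U: "U \<in> ultra_limit G" and pr: "\<And>X. X \<in> fin_vsets G \<Longrightarrow> is_princ G X (U X)"
    unfolding ends_def by auto
  have "U X \<in> crit_filters G X" if "X \<in> fin_vsets G" for X
    using pr[OF that] unfolding is_princ_def crit_filters_def by blast
  moreover have "U \<in> extensional (fin_vsets G)"
    using U unfolding ultra_limit_def PiE_def by blast
  ultimately have "U \<in> (\<Pi>\<^sub>E X\<in>fin_vsets G. crit_filters G X)"
    unfolding PiE_def by blast
  then show "U \<in> crit_limit G"
    unfolding mem_crit_limit using ultra_limitD(2)[OF U] by blast
qed

lemma ultrafilter_on_princ: "C \<in> comps G X \<Longrightarrow> ultrafilter_on (comps G X) (princ G X C)"
  unfolding ultrafilter_on_def princ_def by auto

text \<open>Since \<open>ends\<close> is carved out of \<open>ultra_limit\<close>, this and the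
  preceding inclusion are what makes the ends a common part of both limits.\<close>

lemma crit_limit_princ_in_ends:
  assumes F: "F \<in> crit_limit G" and pr: "\<And>X. X \<in> fin_vsets G \<Longrightarrow> is_princ G X (F X)"
  shows "F \<in> ends G"
proof -
  have "ultrafilter_on (comps G X) (F X)" if "X \<in> fin_vsets G" for X
    using pr[OF that] ultrafilter_on_princ unfolding is_princ_def by metis
  moreover have "F \<in> extensional (fin_vsets G)"
    using F unfolding crit_limit_def PiE_def by blast
  ultimately have "F \<in> (\<Pi>\<^sub>E X\<in>fin_vsets G. {F. ultrafilter_on (comps G X) F})"
    unfolding PiE_def by blast
  then have "F \<in> ultra_limit G"
    using crit_limitD(2)[OF F] unfolding ultra_limit_def by blast
  then show ?thesis using pr unfolding ends_def by blast
qed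

text \<open>The value at \<open>X \<union> X'\<close> must be critical with the same
  \<open>Y\<close>: a principal filter, or a critical one for a set not inside \<open>X\<close>,
  would become principal at \<open>X\<close>. From there the value is carried down to
  \<open>X'\<close>, where it stays critical exactly as long as \<open>Y\<close> is not cut.\<close>

lemma crit_limit_crit_propagate:
  assumes F: "F \<in> crit_limit G" and X: "X \<in> fin_vsets G" and X': "X' \<in> fin_vsets G"
    and Y: "Y \<in> crit G X" and FX: "F X = crit_filter G X Y"
  shows "F X' = ultra_map G (X' \<union> Y) X' (crit_filter G (X' \<union> Y) Y)"
    and "\<not> is_princ G X' (F X') \<Longrightarrow> Y \<subseteq> X' \<and> F X' = crit_filter G X' Y"
proof -
  let ?Z = "X \<union> X'"
  have Z: "?Z \<in> fin_vsets G" by (rule fin_vsets_Un[OF X X'])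
  have YX: "Y \<subseteq> X" using Y by (simp add: crit_def)
  have FZ: "F ?Z = crit_filter G ?Z Y" and YZ: "Y \<in> crit G ?Z"
  proof -
    have up: "ultra_map G ?Z X (F ?Z) = crit_filter G X Y"
      using crit_limitD(2)[OF F X Z] FX by simp
    have np: "ultra_map G ?Z X (F ?Z) \<noteq> princ G X C" if "C \<in> comps G X" for C
      using crit_filter_not_princ[OF Y] that up unfolding is_princ_def by metis
    have "\<exists>W. W \<in> crit G ?Z \<and> F ?Z = crit_filter G ?Z W"
      using crit_limitD(1)[OF F Z]
    proof (cases rule: crit_filters_cases)
      case (princ C)
      then show ?thesis
        using np[OF comp_map(1)[OF princ(1)]] ultra_map_princ[OF _ princ(1), of X] by simp
    qed blast
    then obtain W where W: "W \<in> crit G ?Z" "F ?Z = crit_filter G ?Z W" by blast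
    have "W \<subseteq> X"
    proof (rule ccontr)
      assume "\<not> W \<subseteq> X"
      then obtain D where D: "D \<in> comps G X" "\<And>C. C \<in> comps_with_nbhd G ?Z W \<Longrightarrow> C \<subseteq> D"
        using crit_collapse[OF Un_upper1 _ W(1)] by metis
      show False
        using ultra_map_crit_filter_collapse[OF Un_upper1 W(1) D] np[OF D(1)] W(2) by simp
    qed
    then have "crit_filter G X W = crit_filter G X Y"
      using ultra_map_crit_filter[OF _ Un_upper1 fin_vsets_finite[OF Z]] up W(2) by metis
    then have "W = Y" using crit_filter_inj[OF Y] by metis
    then show "F ?Z = crit_filter G ?Z Y" "Y \<in> crit G ?Z" using W by simp_all
  qed
  have Z': "X' \<union> Y \<in> fin_vsets G" using fin_vsets_Un[OF X'] fin_vsets_subset[OF X YX] by blast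
  \<comment> \<open>The stop at \<open>X' \<union> Y\<close> keeps \<open>Y\<close> inside the level
    and removes \<open>X\<close> from the formula, so the value at \<open>X'\<close> depends on
    \<open>Y\<close> and \<open>X'\<close> only.\<close>
  have "F (X' \<union> Y) = ultra_map G ?Z (X' \<union> Y) (crit_filter G ?Z Y)"
    using crit_limitD(2)[OF F Z' Z] YX FZ by auto
  also have "\<dots> = crit_filter G (X' \<union> Y) Y"
    using ultra_map_crit_filter[OF Un_upper2, of X' Y ?Z] YX fin_vsets_finite[OF Z] by blast
  finally show eq: "F X' = ultra_map G (X' \<union> Y) X' (crit_filter G (X' \<union> Y) Y)"
    using crit_limitD(2)[OF F X' Z'] by auto
  show "Y \<subseteq> X' \<and> F X' = crit_filter G X' Y" if np: "\<not> is_princ G X' (F X')"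
  proof
    have YZ': "Y \<in> crit G (X' \<union> Y)"
      using crit_change[OF Y fin_vsets_finite[OF Z']] by blast
    show sub: "Y \<subseteq> X'"
    proof (rule ccontr)
      assume "\<not> Y \<subseteq> X'"
      then obtain D where D: "D \<in> comps G X'" "\<And>C. C \<in> comps_with_nbhd G (X' \<union> Y) Y \<Longrightarrow> C \<subseteq> D"
        using crit_collapse[OF Un_upper1 _ YZ'] by metis
      show False
        using ultra_map_crit_filter_collapse[OF Un_upper1 YZ' D] np D(1) eq
        unfolding is_princ_def by metis
    qed
    show "F X' = crit_filter G X' Y"
      using ultra_map_crit_filter[OF sub Un_upper1 fin_vsets_finite[OF Z']] eq by simp
  qed
qed

section \<open>The least non-principal level of a family\<close>

lemma least_nonprinc_unique:
  assumes "least_nonprinc G F X" "least_nonprinc G F Y"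
  shows "X = Y"
  using assms unfolding least_nonprinc_def by (intro equalityI) blast+

text \<open>The set \<open>Y\<close> is read off from the critical filter at \<open>X\<close>.
  Propagation makes the value at \<open>Y\<close> critical too and shows that every non-principal
  level contains \<open>Y\<close>.\<close>

lemma crit_limit_least_nonprinc:
  assumes F: "F \<in> crit_limit G" and "X \<in> fin_vsets G" "\<not> is_princ G X (F X)"
  obtains Y where "least_nonprinc G F Y" "Y \<in> crit G Y" "F Y = crit_filter G Y Y" "Y \<subseteq> X"
    "F X = crit_filter G X Y"
proof -
  obtain Y where Y: "Y \<in> crit G X" "F X = crit_filter G X Y"
    using crit_limitD(1)[OF F assms(2)]
  proof (cases rule: crit_filters_cases)
    case (princ C)
    then show thesis using assms(3) unfolding is_princ_def by blast
  qed (use that in blast)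
  note propagate = crit_limit_crit_propagate[OF F assms(2) _ Y]
  have YX: "Y \<subseteq> X" using Y(1) by (simp add: crit_def)
  have Yf: "Y \<in> fin_vsets G" by (rule fin_vsets_subset[OF assms(2) YX])
  have YY: "Y \<in> crit G Y" by (rule crit_change[OF Y(1) fin_vsets_finite[OF Yf]]) simp
  have "F Y = crit_filter G Y Y"
    using propagate(1)[OF Yf] ultra_map_crit_filter[of Y Y Y G] fin_vsets_finite[OF Yf] by simp
  moreover from this have "\<not> is_princ G Y (F Y)" using crit_filter_not_princ[OF YY] by simp
  then have "least_nonprinc G F Y"
    unfolding least_nonprinc_def using Yf propagate(2) by blast
  ultimately show thesis using that YY YX Y(2) by blast
qed

text \<open>The value at the least level \<open>Y\<close> has to be
  \<open>crit_filter G Y Y\<close>, for the critical set labelling it is itself a least level.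
  Propagation then prescribes all other values.\<close>

lemma crit_limit_eqI:
  assumes F: "F \<in> crit_limit G" "least_nonprinc G F Y"
    and F': "F' \<in> crit_limit G" "least_nonprinc G F' Y"
  shows "F = F'"
proof -
  have Yf: "Y \<in> fin_vsets G" using F(2) by (simp add: least_nonprinc_def)
  have val: "H X = ultra_map G (X \<union> Y) X (crit_filter G (X \<union> Y) Y)"
    if H: "H \<in> crit_limit G" "least_nonprinc G H Y" and X: "X \<in> fin_vsets G" for H X
  proof -
    have "\<not> is_princ G Y (H Y)" using H(2) by (simp add: least_nonprinc_def)
    then obtain Z where Z: "least_nonprinc G H Z" "Z \<in> crit G Z" "H Z = crit_filter G Z Z"
      using crit_limit_least_nonprinc[OF H(1) Yf] by metis
    have "Z = Y" by (rule least_nonprinc_unique[OF Z(1) H(2)])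
    then show ?thesis using crit_limit_crit_propagate(1)[OF H(1) Yf X] Z by simp
  qed
  show ?thesis
  proof (rule PiE_ext)
    show "F \<in> (\<Pi>\<^sub>E X\<in>fin_vsets G. crit_filters G X)" "F' \<in> (\<Pi>\<^sub>E X\<in>fin_vsets G. crit_filters G X)"
      using F(1) F'(1) by (simp_all add: mem_crit_limit)
    show "F X = F' X" if "X \<in> fin_vsets G" for X
      using val[OF F that] val[OF F' that] by simp
  qed
qed

section \<open>The map on limit points and its fibres\<close>

lemma ends_subset_ultra_limit: "ends G \<subseteq> ultra_limit G"
  unfolding ends_def by blast

lemma least_nonprinc_not_ends:
  "least_nonprinc G F Y \<Longrightarrow> F \<notin> ends G"
  unfolding least_nonprinc_def ends_def by blast

text \<open>The family \<open>F\<close> found below \<open>v\<close> has the same non-principal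
  levels as \<open>v\<close>. Hence the two definite descriptions, in \<open>X_of\<close> and in
  \<open>Psi_rep\<close>, denote, and the latter denotes \<open>F\<close>.\<close>

lemma ultra_tangle_props:
  assumes v: "v \<in> ultra_tangles G"
  shows "least_nonprinc G v (X_of G v)"
    and "\<exists>!F. F \<in> crit_limit G - ends G \<and> least_nonprinc G F (X_of G v)"
    and "Psi_rep G v \<in> crit_limit G - ends G" "least_nonprinc G (Psi_rep G v) (X_of G v)"
    and "\<And>X. X \<in> fin_vsets G \<Longrightarrow> Psi_rep G v X \<subseteq> v X"
proof -
  have vU: "v \<in> ultra_limit G" and ve: "v \<notin> ends G" using v unfolding ultra_tangles_def by blast+
  obtain F where F: "F \<in> crit_limit G" and below: "\<And>X. X \<in> fin_vsets G \<Longrightarrow> F X \<subseteq> v X"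
    using family_below_exists[OF vU] by metis
  have iff: "is_princ G X (F X) \<longleftrightarrow> is_princ G X (v X)" if "X \<in> fin_vsets G" for X
    by (rule is_princ_below_iff[OF ultra_limitD(1)[OF vU that] crit_limitD(1)[OF F that] below[OF that]])
  have least: "least_nonprinc G F X \<longleftrightarrow> least_nonprinc G v X" for X
    unfolding least_nonprinc_def using iff by auto
  obtain X where X: "X \<in> fin_vsets G" "\<not> is_princ G X (v X)"
    using vU ve unfolding ends_def by blast
  then obtain Y where Y: "least_nonprinc G F Y"
    using crit_limit_least_nonprinc[OF F X(1)] iff[OF X(1)] by metis
  have "X_of G v = Y"
    unfolding X_of_def using Y least least_nonprinc_unique by (intro the_equality) blast+
  then have FX: "least_nonprinc G F (X_of G v)" using Y by simp
  then show "least_nonprinc G v (X_of G v)" using least by blast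
  have uniq: "H = F" if "H \<in> crit_limit G - ends G \<and> least_nonprinc G H (X_of G v)" for H
    using crit_limit_eqI[OF _ _ F FX] that by blast
  have mem: "F \<in> crit_limit G - ends G \<and> least_nonprinc G F (X_of G v)"
    using F FX least_nonprinc_not_ends[OF FX] by blast
  show "\<exists>!F. F \<in> crit_limit G - ends G \<and> least_nonprinc G F (X_of G v)"
    using mem uniq by (intro ex1I[of _ F])
  have "Psi_rep G v = F"
    unfolding Psi_rep_def if_not_P[OF ve] using mem uniq by (rule the_equality)
  then show "Psi_rep G v \<in> crit_limit G - ends G" "least_nonprinc G (Psi_rep G v) (X_of G v)"
    "\<And>X. X \<in> fin_vsets G \<Longrightarrow> Psi_rep G v X \<subseteq> v X"
    using mem below by simp_all
qed

lemma Psi_rep_below: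
  assumes "v \<in> ultra_limit G"
  shows "Psi_rep G v \<in> crit_limit G" and "X \<in> fin_vsets G \<Longrightarrow> Psi_rep G v X \<subseteq> v X"
proof -
  have "Psi_rep G v \<in> crit_limit G \<and> (X \<in> fin_vsets G \<longrightarrow> Psi_rep G v X \<subseteq> v X)"
  proof (cases "v \<in> ends G")
    case True
    then show ?thesis using ends_subset_crit_limit[of G] by (auto simp: Psi_rep_def)
  next
    case False
    then have "v \<in> ultra_tangles G" using assms unfolding ultra_tangles_def by blast
    then show ?thesis using ultra_tangle_props(3,5) by blast
  qed
  then show "Psi_rep G v \<in> crit_limit G" "X \<in> fin_vsets G \<Longrightarrow> Psi_rep G v X \<subseteq> v X" by blast+
qed

lemma Psi_rep_end: "v \<in> ends G \<Longrightarrow> Psi_rep G v = v"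
  by (simp add: Psi_rep_def)

text \<open>Ends are fixed and ultrafilter tangles are sent outside \<open>ends G\<close>, so the
  two kinds never share an image; among tangles the image and its least level determine each
  other.\<close>

lemma Psi_rep_eq_iff:
  assumes v: "v \<in> ultra_limit G" and w: "w \<in> ultra_limit G"
  shows "Psi_rep G v = Psi_rep G w \<longleftrightarrow>
    v = w \<or> v \<in> ultra_tangles G \<and> w \<in> ultra_tangles G \<and> X_of G v = X_of G w"
proof -
  have cases: "u \<in> ends G \<and> Psi_rep G u = u \<or> u \<in> ultra_tangles G \<and> Psi_rep G u \<notin> ends G"
    if "u \<in> ultra_limit G" for u
    using that ultra_tangle_props(3)[of u G] Psi_rep_end[of u G] unfolding ultra_tangles_def by blast
  have "Psi_rep G v = Psi_rep G w \<longleftrightarrow> X_of G v = X_of G w"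
    if vw: "v \<in> ultra_tangles G" "w \<in> ultra_tangles G"
  proof
    assume "Psi_rep G v = Psi_rep G w"
    then show "X_of G v = X_of G w"
      using ultra_tangle_props(4)[OF vw(1)] ultra_tangle_props(4)[OF vw(2)] least_nonprinc_unique
      by metis
  next
    assume "X_of G v = X_of G w"
    then show "Psi_rep G v = Psi_rep G w"
      using vw unfolding Psi_rep_def ultra_tangles_def by simp
  qed
  then show ?thesis using cases[OF v] cases[OF w] by metis
qed

text \<open>A component \<open>C\<close> in \<open>\<C>\<^sub>Y(Y)\<close> that avoids \<open>X\<close> lies in exactly one component of \<open>G - X\<close>. As
  only finitely many \<open>C\<close> meet \<open>X\<close>, a free ultrafilter on \<open>\<C>\<^sub>Y(Y)\<close> can be pushed forward to every
  \<open>\<C>\<^sub>X\<close>.\<close>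

lemma free_ultrafilter_extends:
  assumes Y: "Y \<in> crit G Y" "Y \<in> fin_vsets G"
    and W: "ultrafilter_on (comps_with_nbhd G Y Y) W" and free: "\<And>A. finite A \<Longrightarrow> A \<notin> W"
  obtains v where "v \<in> ultra_limit G"
    "\<And>A. A \<subseteq> comps G Y \<Longrightarrow> A \<in> v Y \<longleftrightarrow> A \<inter> comps_with_nbhd G Y Y \<in> W"
proof -
  let ?S = "comps_with_nbhd G Y Y"
  \<comment> \<open>The trace of \<open>A\<close> on the class: its components that lie inside a
    member of \<open>A\<close>. Using traces gives the pushforward without a value for the
    components that meet \<open>X\<close>.\<close>
  define tr where "tr A = {C \<in> ?S. \<exists>D\<in>A. C \<subseteq> D}" for A
  define v where "v = (\<lambda>X\<in>fin_vsets G. {A. A \<subseteq> comps G X \<and> tr A \<in> W})"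
  have mem: "A \<in> v X \<longleftrightarrow> A \<subseteq> comps G X \<and> tr A \<in> W" if "X \<in> fin_vsets G" for A X
    using that by (simp add: v_def)
  have Sne: "C \<noteq> {}" if "C \<in> ?S" for C
    using that comps_nonempty[of C G Y] comps_with_nbhd_subset_comps[of G Y Y] by blast
  have trS: "tr A \<subseteq> ?S" for A unfolding tr_def by blast
  have tr_mono: "tr A \<subseteq> tr B" if "A \<subseteq> B" for A B using that unfolding tr_def by blast
  have tr_comps: "tr (comps G X) \<in> W" if X: "X \<in> fin_vsets G" for X
  proof -
    have "?S - tr (comps G X) \<subseteq> {C \<in> comps G Y. C \<inter> X \<noteq> {}}"
      using comp_within_comp[of _ G Y X] comps_with_nbhd_subset_comps[of G Y Y]
      unfolding tr_def by blast
    then have "finite (?S - tr (comps G X))"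
      using finite_comps_meeting[OF fin_vsets_finite[OF X]] finite_subset by blast
    then show ?thesis
      using free ultrafilter_onD(6)[OF W, of "tr (comps G X)"] trS by blast
  qed
  \<comment> \<open>A nonempty component lies in at most one component of \<open>G - X\<close>, so
    the two witnesses coincide.\<close>
  have tr_Int: "tr A \<inter> tr B \<subseteq> tr (A \<inter> B)" if AB: "A \<subseteq> comps G X" "B \<subseteq> comps G X" for A B X
  proof
    fix C assume "C \<in> tr A \<inter> tr B"
    then obtain D E where C: "C \<in> ?S" and D: "D \<in> A" "C \<subseteq> D" and E: "E \<in> B" "C \<subseteq> E"
      unfolding tr_def by blast
    then have "D = E" using comps_superset_unique[OF Sne[OF C] D(2) E(2)] AB by blast
    then show "C \<in> tr (A \<inter> B)" using C D E unfolding tr_def by blast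
  qed
  have "ultrafilter_on (comps G X) (v X)" if X: "X \<in> fin_vsets G" for X
    unfolding ultrafilter_on_def
  proof (intro conjI ballI allI impI)
    show "v X \<subseteq> Pow (comps G X)" using mem[OF X] by blast
    show "comps G X \<in> v X" using mem[OF X] tr_comps[OF X] by blast
    show "{} \<notin> v X" using mem[OF X, of "{}"] ultrafilter_onD(3)[OF W] by (simp add: tr_def)
  next
    fix A B assume A: "A \<in> v X"
    show "A \<inter> B \<in> v X" if B: "B \<in> v X"
    proof -
      have "tr A \<inter> tr B \<in> W" using A B mem[OF X] ultrafilter_onD(4)[OF W] by blast
      then have "tr (A \<inter> B) \<in> W"
        using ultrafilter_onD(5)[OF W _ tr_Int trS] A B mem[OF X] by blast
      then show ?thesis using A mem[OF X] by blast
    qed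
    show "B \<in> v X" if B: "A \<subseteq> B \<and> B \<subseteq> comps G X"
      using A B mem[OF X] ultrafilter_onD(5)[OF W _ tr_mono trS] by blast
  next
    fix A assume A: "A \<subseteq> comps G X"
    have "tr (comps G X) = tr A \<union> tr (comps G X - A)" using A unfolding tr_def by blast
    then have "tr A \<in> W \<or> tr (comps G X - A) \<in> W"
      using tr_comps[OF X] ultrafilter_on_Un[OF W] by metis
    then show "A \<in> v X \<or> comps G X - A \<in> v X" using A mem[OF X] by blast
  qed
  moreover have "ultra_map G X' X (v X') = v X"
    if X: "X \<in> fin_vsets G" and X': "X' \<in> fin_vsets G" and sub: "X \<subseteq> X'" for X X'
  proof (intro set_eqI iffI)
    fix A assume A: "A \<in> ultra_map G X' X (v X')"
    then obtain A' where A': "A' \<in> v X'" "comp_map G X' X ` A' \<subseteq> A" unfolding mem_ultra_map by blast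
    have "tr A' \<subseteq> tr A"
    proof
      fix C assume "C \<in> tr A'"
      then obtain D where D: "C \<in> ?S" "D \<in> A'" "C \<subseteq> D" unfolding tr_def by blast
      then have "D \<in> comps G X'" using A'(1) mem[OF X'] by blast
      then have "C \<subseteq> comp_map G X' X D" using comp_map(2)[OF _ sub] D(3) by blast
      then show "C \<in> tr A" using D A'(2) unfolding tr_def by blast
    qed
    moreover have "tr A' \<in> W" using A'(1) mem[OF X'] by blast
    ultimately have "tr A \<in> W" using ultrafilter_onD(5)[OF W _ _ trS] by blast
    then show "A \<in> v X" using A mem[OF X] unfolding mem_ultra_map by blast
  next
    fix A assume A: "A \<in> v X"
    \<comment> \<open>The full preimage of \<open>A\<close> is the largest possible witness; its
      trace contains that of \<open>A\<close> up to components meeting \<open>X'\<close>.\<close>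
    define A' where "A' = {D \<in> comps G X'. comp_map G X' X D \<in> A}"
    have "tr A \<inter> tr (comps G X') \<subseteq> tr A'"
    proof
      fix C assume "C \<in> tr A \<inter> tr (comps G X')"
      then obtain D D' where C: "C \<in> ?S" and D: "D \<in> A" "C \<subseteq> D" and D': "D' \<in> comps G X'" "C \<subseteq> D'"
        unfolding tr_def by blast
      have "C \<subseteq> comp_map G X' X D'" using comp_map(2)[OF D'(1) sub] D'(2) by blast
      then have "comp_map G X' X D' = D"
        using comps_superset_unique[OF Sne[OF C] _ D(2) comp_map(1)[OF D'(1) sub]] A D(1) mem[OF X]
        by blast
      then have "D' \<in> A'" using D' D(1) unfolding A'_def by simp
      then show "C \<in> tr A'" using C D'(2) unfolding tr_def by blast
    qed
    moreover have "tr A \<inter> tr (comps G X') \<in> W"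
      using A mem[OF X] tr_comps[OF X'] ultrafilter_onD(4)[OF W] by blast
    ultimately have "tr A' \<in> W" using ultrafilter_onD(5)[OF W _ _ trS] by blast
    then have "A' \<in> v X'" using mem[OF X'] unfolding A'_def by blast
    moreover have "comp_map G X' X ` A' \<subseteq> A" unfolding A'_def by blast
    ultimately show "A \<in> ultra_map G X' X (v X')"
      unfolding mem_ultra_map using A mem[OF X] by blast
  qed
  moreover have "v \<in> extensional (fin_vsets G)" unfolding v_def by simp
  ultimately have "v \<in> ultra_limit G" unfolding ultra_limit_def PiE_def by blast
  moreover have "A \<in> v Y \<longleftrightarrow> A \<inter> ?S \<in> W" if A: "A \<subseteq> comps G Y" for A
  proof -
    \<comment> \<open>At level \<open>Y\<close> nested components are equal, so there the trace is
      plain intersection with the class.\<close>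
    have "C \<in> A" if "C \<in> ?S" "D \<in> A" "C \<subseteq> D" for C D
    proof -
      have "C = D"
        using comps_superset_unique[OF Sne[OF that(1)] subset_refl that(3), of G Y] that(1,2) A
          comps_with_nbhd_subset_comps[of G Y Y] by blast
      then show ?thesis using that(2) by simp
    qed
    then have "tr A = A \<inter> ?S" unfolding tr_def by blast
    then show ?thesis using mem[OF Y(2)] A by simp
  qed
  ultimately show thesis using that by blast
qed

text \<open>Because \<open>W\<close> is free, the extension contains
  \<open>crit_filter G Y Y\<close> at level \<open>Y\<close>. So the family below it is critical
  there with label \<open>Y\<close>, hence has least level \<open>Y\<close>, and must be
  \<open>F\<close>.\<close>

lemma free_ultrafilter_realized:
  assumes F: "F \<in> crit_limit G" "least_nonprinc G F Y"
    and W: "ultrafilter_on (comps_with_nbhd G Y Y) W" and free: "\<And>A. finite A \<Longrightarrow> A \<notin> W"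
  obtains v where "v \<in> ultra_tangles G" "X_of G v = Y" "Psi_rep G v = F"
    "\<And>A. A \<subseteq> comps G Y \<Longrightarrow> A \<in> v Y \<longleftrightarrow> A \<inter> comps_with_nbhd G Y Y \<in> W"
proof -
  let ?S = "comps_with_nbhd G Y Y"
  have Yf: "Y \<in> fin_vsets G" and np: "\<not> is_princ G Y (F Y)"
    using F(2) unfolding least_nonprinc_def by blast+
  obtain Z where Z: "least_nonprinc G F Z" "Z \<in> crit G Z"
    using crit_limit_least_nonprinc[OF F(1) Yf np] by metis
  have "Z = Y" by (rule least_nonprinc_unique[OF Z(1) F(2)])
  then have YY: "Y \<in> crit G Y" using Z(2) by simp
  obtain v where v: "v \<in> ultra_limit G"
    and vY: "\<And>A. A \<subseteq> comps G Y \<Longrightarrow> A \<in> v Y \<longleftrightarrow> A \<inter> ?S \<in> W"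
    using free_ultrafilter_extends[OF YY Yf W free] by metis
  have below: "crit_filter G Y Y \<subseteq> v Y"
  proof
    fix A assume A: "A \<in> crit_filter G Y Y"
    then have "?S - (A \<inter> ?S) \<notin> W"
      using free by (simp add: mem_crit_filter Diff_Int)
    then have "A \<inter> ?S \<in> W" using ultrafilter_onD(6)[OF W, of "A \<inter> ?S"] by blast
    then show "A \<in> v Y" using vY A by (simp add: mem_crit_filter)
  qed
  have cf: "crit_filter G Y Y \<in> crit_filters G Y" using YY unfolding crit_filters_def by blast
  have "\<not> is_princ G Y (v Y)"
    using is_princ_below_iff[OF ultra_limitD(1)[OF v Yf] cf below] crit_filter_not_princ[OF YY] by blast
  then have vt: "v \<in> ultra_tangles G" using v Yf unfolding ultra_tangles_def ends_def by blast
  have PY: "Psi_rep G v Y = crit_filter G Y Y"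
    using crit_filters_below_unique[OF ultra_limitD(1)[OF v Yf] crit_limitD(1)[OF Psi_rep_below(1)[OF v] Yf]
      Psi_rep_below(2)[OF v Yf] cf below] .
  then have "\<not> is_princ G Y (Psi_rep G v Y)" using crit_filter_not_princ[OF YY] by simp
  then obtain Z' where Z': "least_nonprinc G (Psi_rep G v) Z'" "Psi_rep G v Y = crit_filter G Y Z'"
    using crit_limit_least_nonprinc[OF Psi_rep_below(1)[OF v] Yf] by metis
  have "Z' = Y" using crit_filter_inj[OF YY] PY Z'(2) by metis
  then have lY: "least_nonprinc G (Psi_rep G v) Y" using Z'(1) by simp
  have "X_of G v = Y" by (rule least_nonprinc_unique[OF ultra_tangle_props(4)[OF vt] lY])
  moreover have "Psi_rep G v = F" by (rule crit_limit_eqI[OF Psi_rep_below(1)[OF v] lY F])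
  ultimately show thesis using that vt vY by blast
qed

lemma crit_limit_least_nonprinc_ex:
  assumes "F \<in> crit_limit G" "F \<notin> ends G"
  obtains Y where "least_nonprinc G F Y" "Y \<in> crit G Y" "F Y = crit_filter G Y Y"
proof -
  obtain X where X: "X \<in> fin_vsets G" "\<not> is_princ G X (F X)"
    using crit_limit_princ_in_ends[OF assms(1)] assms(2) by metis
  show thesis by (rule crit_limit_least_nonprinc[OF assms(1) X]) (rule that)
qed

lemma Psi_rep_surj: "Psi_rep G ` ultra_limit G = crit_limit G"
proof
  show "Psi_rep G ` ultra_limit G \<subseteq> crit_limit G" using Psi_rep_below(1) by blast
  show "crit_limit G \<subseteq> Psi_rep G ` ultra_limit G"
  proof
    fix F assume F: "F \<in> crit_limit G"
    show "F \<in> Psi_rep G ` ultra_limit G"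
    proof (cases "F \<in> ends G")
      case True
      then show ?thesis using Psi_rep_end[OF True] ends_subset_ultra_limit[of G] by (metis imageI subsetD)
    next
      case False
      obtain Y where Y: "least_nonprinc G F Y" "Y \<in> crit G Y"
        using crit_limit_least_nonprinc_ex[OF F False] by metis
      have "infinite (comps_with_nbhd G Y Y)" using Y(2) by (simp add: crit_def)
      \<comment> \<open>The ideal of finite sets is proper on the class because \<open>Y\<close> is
        critical.\<close>
      then obtain W where W: "ultrafilter_on (comps_with_nbhd G Y Y) W" "W \<inter> {A. finite A} = {}"
        using ultrafilter_avoiding_ideal[of "{A. finite A}" "comps_with_nbhd G Y Y"]
        by (metis (no_types, lifting) finite.emptyI finite_UnI mem_Collect_eq rev_finite_subset)
      have "A \<notin> W" if "finite A" for A using W(2) that by blast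
      then obtain v where "v \<in> ultra_tangles G" "Psi_rep G v = F"
        using free_ultrafilter_realized[OF F Y(1) W(1)] by metis
      then show ?thesis unfolding ultra_tangles_def by blast
    qed
  qed
qed

text \<open>Membership in these sets does not distinguish an ultrafilter from the filter of \<open>\<F>\<^sub>X\<close> below it,
  so basic open sets of the two spaces correspond to each other.\<close>

lemma crit_filters_mem_singleton:
  assumes U: "ultrafilter_on (comps G X) U" and F: "F \<in> crit_filters G X" "F \<subseteq> U"
    and C: "C \<in> comps G X"
  shows "{C} \<in> F \<longleftrightarrow> {C} \<in> U"
proof
  assume "{C} \<in> U"
  then have U': "U = princ G X C" by (rule ultrafilter_on_princI[OF U])
  then have "U \<in> crit_filters G X" using C unfolding crit_filters_def by blast
  then have "F = U" using crit_filters_below_unique[OF U F] by blast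
  then show "{C} \<in> F" using \<open>{C} \<in> U\<close> by simp
qed (use F(2) in blast)

lemma crit_filters_mem_cofin:
  assumes U: "ultrafilter_on (comps G X) U" and F: "F \<in> crit_filters G X" "F \<subseteq> U"
    and A: "cofin_subset A (comps_with_nbhd G X Y)"
  shows "A \<in> F \<longleftrightarrow> A \<in> U"
proof
  assume AU: "A \<in> U"
  show "A \<in> F" using F(1)
  proof (cases rule: crit_filters_cases)
    case (princ C)
    then show ?thesis using princ_below_ultrafilter[OF U] F(2) AU by metis
  next
    case (crit Z)
    have "A \<inter> comps_with_nbhd G X Z \<in> U"
      using ultrafilter_onD(4)[OF U AU] crit_filter_subset_ultrafilter(1)[OF U] F(2) crit(2) by blast
    \<comment> \<open>A nonempty intersection identifies the two classes, since distinct classes are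
      disjoint.\<close>
    then have "A \<inter> comps_with_nbhd G X Z \<noteq> {}" using ultrafilter_onD(3)[OF U] by metis
    then have "Y = Z"
      using A comps_with_nbhd_disjoint[of Y Z G X] unfolding cofin_subset_def by blast
    then show ?thesis
      using A crit(2) comps_with_nbhd_subset_comps[of G X Y]
      unfolding cofin_subset_def by (auto simp: mem_crit_filter)
  qed
qed (use F(2) in blast)

subsection \<open>The topologies\<close>

text \<open>The star at \<open>u\<close> with every incident edge taken up to, but without, its far
  end. Generators of \<open>complex_topology\<close> have radius below 1, so this is not one of them
  in general. The graph part of a basic open set is a union of such stars and therefore depends only
  on the vertices covered.\<close>

definition full_star :: "'v ugraph \<Rightarrow> 'v \<Rightarrow> 'v point set" where
  "full_star G u = insert (vertex_pt u) {edge_pt u v t | v t. {u, v} \<in> edges G \<and> 0 < t \<and> t < 1}"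

lemma simple_graph_edge:
  assumes "simple_graph G" "{u, v} \<in> edges G"
  shows "u \<in> verts G" "v \<in> verts G" "u \<noteq> v"
proof -
  have e: "{u, v} \<subseteq> verts G" "card {u, v} = 2"
    using bspec[OF assms(1)[unfolded simple_graph_def] assms(2)] by simp_all
  then show "u \<in> verts G" "v \<in> verts G" by auto
  show "u \<noteq> v" using e(2) by auto
qed

lemma inner_pts_subset_full_star:
  assumes "simple_graph G" "{u, v} \<in> edges G"
  shows "inner_pts {u, v} \<subseteq> full_star G u"
proof
  fix p assume "p \<in> inner_pts {u, v}"
  then obtain a b t where p: "{u, v} = {a, b}" "0 < t" "t < 1" "p = edge_pt a b t"
    unfolding inner_pts_def by blast
  then consider "a = u" "b = v" | "a = v" "b = u" by (auto simp: doubleton_eq_iff)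
  then show "p \<in> full_star G u"
  proof cases
    case 1
    then show ?thesis using p assms(2) unfolding full_star_def by blast
  next
    case 2
    then have "p = edge_pt u v (1 - t)"
      using p(4) edge_pt_swap[OF simple_graph_edge(3)[OF assms]] by simp
    moreover have "0 < 1 - t" "1 - t < 1" using p by simp_all
    ultimately show ?thesis using assms(2) unfolding full_star_def by blast
  qed
qed

text \<open>The other end of an edge at a vertex of a component \<open>C\<close> of
  \<open>G - X\<close> lies either in \<open>C\<close> or in \<open>X\<close>; the two cases give
  the two parts of the left side.\<close>

lemma realization_inner_between_eq:
  assumes G: "simple_graph G" and A: "A \<subseteq> comps G X"
  shows "realization G (\<Union>A) \<union> inner_between G X (\<Union>A) = (\<Union>u\<in>\<Union>A. full_star G u)"
proof (intro equalityI subsetI)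
  fix p assume "p \<in> realization G (\<Union>A) \<union> inner_between G X (\<Union>A)"
  then consider (v) "p \<in> vertex_pt ` (\<Union>A \<inter> verts G)"
    | (r) "p \<in> \<Union> (inner_pts ` {e \<in> edges G. e \<subseteq> \<Union>A})"
    | (b) "p \<in> \<Union> (inner_pts ` {e \<in> edges G. \<exists>x\<in>X. \<exists>w\<in>\<Union>A. e = {x, w}})"
    unfolding realization_def inner_between_def by (elim UnE)
  then show "p \<in> (\<Union>u\<in>\<Union>A. full_star G u)"
  proof cases
    case v
    then show ?thesis unfolding full_star_def by blast
  next
    case r
    then obtain e where e: "e \<in> edges G" "e \<subseteq> \<Union>A" "p \<in> inner_pts e" by blast
    then obtain a b where "e = {a, b}" unfolding inner_pts_def by blast
    then show ?thesis using e inner_pts_subset_full_star[OF G, of a b] by blast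
  next
    case b
    then obtain e x w where "e \<in> edges G" "p \<in> inner_pts e" "w \<in> \<Union>A" "e = {x, w}" by blast
    then have w: "{x, w} \<in> edges G" "w \<in> \<Union>A" "p \<in> inner_pts {x, w}" by simp_all
    have "{w, x} \<in> edges G" "p \<in> inner_pts {w, x}"
      using w(1,3) by (simp_all add: insert_commute)
    then show ?thesis using w(2) inner_pts_subset_full_star[OF G, of w x] by blast
  qed
next
  fix p assume "p \<in> (\<Union>u\<in>\<Union>A. full_star G u)"
  then obtain u C where u: "u \<in> C" "C \<in> A" "p \<in> full_star G u" by blast
  have C: "C \<in> comps G X" using u(2) A by blast
  consider (v) "p = vertex_pt u"
    | (e) v t where "{u, v} \<in> edges G" "0 < t" "t < 1" "p = edge_pt u v t"
    using u(3) unfolding full_star_def by blast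
  then show "p \<in> realization G (\<Union>A) \<union> inner_between G X (\<Union>A)"
  proof cases
    case v
    then show ?thesis using u comps_subset[OF C] unfolding realization_def by blast
  next
    case e
    have p: "p \<in> inner_pts {u, v}" using e unfolding inner_pts_def by blast
    show ?thesis
    proof (cases "v \<in> X")
      case True
      have "u \<in> \<Union>A" using u(1,2) by blast
      with insert_commute[of u v "{}"] have "\<exists>w\<in>\<Union>A. {u, v} = {v, w}" by (rule bexI)
      then have "\<exists>x\<in>X. \<exists>w\<in>\<Union>A. {u, v} = {x, w}" using True by (rule bexI)
      then have "{u, v} \<in> {e \<in> edges G. \<exists>x\<in>X. \<exists>w\<in>\<Union>A. e = {x, w}}"
        using e(1) by (intro CollectI conjI)
      then have "p \<in> inner_between G X (\<Union>A)" unfolding inner_between_def using p by (rule UN_I)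
      then show ?thesis by blast
    next
      case False
      then have "v \<in> C" using comps_edge[OF C u(1) e(1)] simple_graph_edge(2)[OF G e(1)] by blast
      then have "{u, v} \<subseteq> \<Union>A" using u by blast
      then have "{u, v} \<in> {e \<in> edges G. e \<subseteq> \<Union>A}" using e(1) by simp
      then have "p \<in> \<Union> (inner_pts ` {e \<in> edges G. e \<subseteq> \<Union>A})" using p by (rule UN_I)
      then have "p \<in> realization G (\<Union>A)" unfolding realization_def by (rule UnI2)
      then show ?thesis by blast
    qed
  qed
qed

lemma basic_open_eq:
  assumes "simple_graph G" "A \<subseteq> comps G X"
  shows "basic_open G L X A = Inl ` (\<Union>u\<in>\<Union>A. full_star G u) \<union> Inr ` {F \<in> L. A \<in> F X}"
  unfolding basic_open_def realization_inner_between_eq[OF assms] ..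

lemma Inl_mem_basic_open:
  assumes "simple_graph G" "A \<subseteq> comps G X"
  shows "Inl a \<in> basic_open G L X A \<longleftrightarrow> (\<exists>u\<in>\<Union>A. a \<in> full_star G u)"
  unfolding basic_open_eq[OF assms] by auto

lemma Inr_mem_basic_open: "Inr F \<in> basic_open G L X A \<longleftrightarrow> F \<in> L \<and> A \<in> F X"
  unfolding basic_open_def by auto

lemma basic_open_subsetI:
  assumes G: "simple_graph G" and A: "A \<subseteq> comps G X" "B \<subseteq> comps G X'" "\<Union>A \<subseteq> \<Union>B"
    and L: "\<And>F. F \<in> L \<Longrightarrow> A \<in> F X \<Longrightarrow> B \<in> F X'"
  shows "basic_open G L X A \<subseteq> basic_open G L X' B"
proof
  fix x assume x: "x \<in> basic_open G L X A"
  show "x \<in> basic_open G L X' B"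
  proof (cases x)
    case (Inl a)
    have "\<exists>u\<in>\<Union>A. a \<in> full_star G u"
      using x unfolding Inl by (rule Inl_mem_basic_open[OF G A(1), THEN iffD1])
    then have "\<exists>u\<in>\<Union>B. a \<in> full_star G u" by (meson A(3) subsetD)
    then show ?thesis
      unfolding Inl by (rule Inl_mem_basic_open[OF G A(2), THEN iffD2])
  next
    case (Inr F)
    then show ?thesis using x L by (simp add: Inr_mem_basic_open)
  qed
qed

lemma openin_full_star:
  assumes "u \<in> verts G"
  shows "openin (complex_topology G) (full_star G u)"
proof -
  have star: "openin (complex_topology G) (open_star_pts G u (\<lambda>_. 1/2))"
    unfolding complex_topology_def using assms
    by (intro topology_generated_by_Basis UnI2) force
  have seg: "openin (complex_topology G) (open_segment_pts u v 0 1)" if "{u, v} \<in> edges G" for v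
    unfolding complex_topology_def using that
    by (intro topology_generated_by_Basis UnI1) force
  \<comment> \<open>The radius 1/2 is arbitrary below 1: the small star supplies a neighbourhood of
    \<open>u\<close>, the open edges supply the rest.\<close>
  have "full_star G u = open_star_pts G u (\<lambda>_. 1/2) \<union> (\<Union>v\<in>{v. {u, v} \<in> edges G}. open_segment_pts u v 0 1)"
  proof (intro equalityI subsetI)
    fix p assume "p \<in> open_star_pts G u (\<lambda>_. 1/2) \<union> (\<Union>v\<in>{v. {u, v} \<in> edges G}. open_segment_pts u v 0 1)"
    then consider (v) "p = vertex_pt u"
      | (s) v t where "{u, v} \<in> edges G" "0 \<le> t" "t < 1/2" "p = edge_pt u v t"
      | (e) v t where "{u, v} \<in> edges G" "0 < t" "t < 1" "p = edge_pt u v t"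
      unfolding open_star_pts_def open_segment_pts_def by blast
    then show "p \<in> full_star G u"
    proof cases
      case v
      then show ?thesis by (simp add: full_star_def)
    next
      case s
      show ?thesis
      proof (cases "t = 0")
        case True
        then show ?thesis using s(4) by (simp add: full_star_def edge_pt_0)
      next
        case False
        then have "0 < t" "t < 1" using s by simp_all
        then show ?thesis using s(1,4) unfolding full_star_def by blast
      qed
    next
      case e
      then show ?thesis unfolding full_star_def by blast
    qed
  qed (auto simp: full_star_def open_star_pts_def open_segment_pts_def)
  moreover have "openin (complex_topology G)
      (open_star_pts G u (\<lambda>_. 1/2) \<union> (\<Union>v\<in>{v. {u, v} \<in> edges G}. open_segment_pts u v 0 1))"
    using star seg by (intro openin_Un openin_Union) auto
  ultimately show ?thesis by simp
qed

lemma openin_Union_full_star: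
  assumes "A \<subseteq> comps G X"
  shows "openin (complex_topology G) (\<Union>u\<in>\<Union>A. full_star G u)"
proof (rule openin_Union, clarify)
  fix u C assume "u \<in> C" "C \<in> A"
  then have "u \<in> verts G" using assms comps_subset[of C G X] by blast
  then show "openin (complex_topology G) (full_star G u)" by (rule openin_full_star)
qed

section \<open>Generators, traces on the graph, and neighbourhood bases\<close>

lemma openin_theta_basic:
  assumes "X \<in> fin_vsets G" "A \<subseteq> comps G X"
  shows "openin (theta G) (basic_open G (ultra_limit G) X A)"
  unfolding theta_def using assms by (intro topology_generated_by_Basis UnI2) blast

lemma openin_theta_Inl: "openin (complex_topology G) A \<Longrightarrow> openin (theta G) (Inl ` A)"
  unfolding theta_def by (intro topology_generated_by_Basis UnI1) blast

lemma openin_crit_space_Inl: "openin (complex_topology G) A \<Longrightarrow> openin (crit_space G) (Inl ` A)"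
  unfolding crit_space_def by (intro topology_generated_by_Basis UnI1) blast

lemma openin_crit_space_singleton:
  assumes "X \<in> fin_vsets G" "C \<in> comps G X"
  shows "openin (crit_space G) (basic_open G (crit_limit G) X {C})"
  unfolding crit_space_def
  by (rule topology_generated_by_Basis, rule UnI1, rule UnI2) (use assms in blast)

lemma openin_crit_space_cofin:
  assumes "X \<in> fin_vsets G" "Y \<in> crit G X" "cofin_subset A (comps_with_nbhd G X Y)"
  shows "openin (crit_space G) (basic_open G (crit_limit G) X A)"
  unfolding crit_space_def
  by (rule topology_generated_by_Basis, rule UnI2) (use assms in blast)

lemma Inl_vimage_image: "{x. Inl x \<in> Inl ` A \<union> Inr ` B} = A"
  by blast

text \<open>The trace on the graph is open for both kinds of generators, and this property passes to
  finite intersections and unions.\<close>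

lemma openin_theta_Inl_vimage:
  assumes G: "simple_graph G" and "openin (theta G) S"
  shows "openin (complex_topology G) {x. Inl x \<in> S}"
proof -
  have "generate_topology_on
     ({Inl ` A | A. openin (complex_topology G) A} \<union>
      {basic_open G (ultra_limit G) X \<C> | X \<C>. X \<in> fin_vsets G \<and> \<C> \<subseteq> comps G X}) S"
    using assms(2) unfolding theta_def by (rule openin_topology_generated_by)
  then show ?thesis
  proof (induction rule: generate_topology_on.induct)
    case (Int a b)
    have "{x. Inl x \<in> a \<inter> b} = {x. Inl x \<in> a} \<inter> {x. Inl x \<in> b}" by blast
    then show ?case using Int by auto
  next
    case (UN K)
    have "{x. Inl x \<in> \<Union>K} = (\<Union>k\<in>K. {x. Inl x \<in> k})" by blast
    moreover have "openin (complex_topology G) (\<Union>k\<in>K. {x. Inl x \<in> k})"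
      using UN by (intro openin_Union) blast
    ultimately show ?case by simp
  next
    case (Basis s)
    then show ?case
    proof (elim UnE CollectE exE conjE)
      fix A assume A: "s = Inl ` A" "openin (complex_topology G) A"
      have "{x. Inl x \<in> s} = A" using A(1) by auto
      then show ?thesis using A(2) by simp
    next
      fix X \<C> assume 2: "s = basic_open G (ultra_limit G) X \<C>" "\<C> \<subseteq> comps G X"
      have "{x. Inl x \<in> s} = (\<Union>u\<in>\<Union>\<C>. full_star G u)"
        unfolding 2(1) basic_open_eq[OF G 2(2)] by (rule Inl_vimage_image)
      then show ?thesis using openin_Union_full_star[OF 2(2)] by simp
    qed
  qed simp
qed

lemma basic_open_refine:
  assumes G: "simple_graph G" and X: "X \<in> fin_vsets G" "X' \<in> fin_vsets G" "X \<subseteq> X'"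
    and A: "A \<subseteq> comps G X" "A' \<subseteq> comps G X'" "comp_map G X' X ` A' \<subseteq> A"
  shows "basic_open G (ultra_limit G) X' A' \<subseteq> basic_open G (ultra_limit G) X A"
proof -
  have "\<Union>A' \<subseteq> \<Union>A"
  proof
    fix u assume "u \<in> \<Union>A'"
    then obtain C where C: "C \<in> A'" "u \<in> C" by blast
    then have "C \<in> comps G X'" using A(2) by blast
    then have "u \<in> comp_map G X' X C" using comp_map(2)[OF _ X(3)] C(2) by blast
    then show "u \<in> \<Union>A" using A(3) C(1) by blast
  qed
  moreover have "A \<in> U X" if "U \<in> ultra_limit G" "A' \<in> U X'" for U
  proof -
    have "A \<in> ultra_map G X' X (U X')" using that(2) A unfolding mem_ultra_map by blast
    then show ?thesis using ultra_limitD(2)[OF that(1) X(1,2,3)] by simp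
  qed
  ultimately show ?thesis by (rule basic_open_subsetI[OF G A(2,1)])
qed

lemma ultra_limit_pullback:
  assumes U: "U \<in> ultra_limit G" and X: "X \<in> fin_vsets G" "X' \<in> fin_vsets G" "X \<subseteq> X'" and A: "A \<in> U X"
  shows "{C \<in> comps G X'. comp_map G X' X C \<in> A} \<in> U X'"
proof -
  have "A \<in> ultra_map G X' X (U X')" using A ultra_limitD(2)[OF U X] by simp
  then obtain A' where A': "A' \<in> U X'" "comp_map G X' X ` A' \<subseteq> A" unfolding mem_ultra_map by blast
  have "A' \<subseteq> {C \<in> comps G X'. comp_map G X' X C \<in> A}"
    using A'(2) ultrafilter_onD(1)[OF ultra_limitD(1)[OF U X(2)] A'(1)] by blast
  then show ?thesis using ultrafilter_onD(5)[OF ultra_limitD(1)[OF U X(2)] A'(1)] by blast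
qed

text \<open>The basic sets are given only as part of a subbase. Two of them, at levels
  \<open>X1\<close> and \<open>X2\<close>, are intersected by pulling both sets of components back
  to \<open>X1 \<union> X2\<close>; generators inside the graph contain no limit point.\<close>

lemma theta_nbhd_base:
  assumes G: "simple_graph G" and "openin (theta G) S" "Inr v \<in> S" and v: "v \<in> ultra_limit G"
  obtains X A where "X \<in> fin_vsets G" "A \<in> v X" "basic_open G (ultra_limit G) X A \<subseteq> S"
proof -
  note uf = ultra_limitD(1)[OF v]
  have "generate_topology_on
     ({Inl ` A | A. openin (complex_topology G) A} \<union>
      {basic_open G (ultra_limit G) X \<C> | X \<C>. X \<in> fin_vsets G \<and> \<C> \<subseteq> comps G X}) S"
    using assms(2) unfolding theta_def by (rule openin_topology_generated_by)
  then have "\<exists>X\<in>fin_vsets G. \<exists>A\<in>v X. basic_open G (ultra_limit G) X A \<subseteq> S"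
    using assms(3)
  proof (induction rule: generate_topology_on.induct)
    case (Int a b)
    obtain X1 A1 where 1: "X1 \<in> fin_vsets G" "A1 \<in> v X1" "basic_open G (ultra_limit G) X1 A1 \<subseteq> a"
      using Int by blast
    obtain X2 A2 where 2: "X2 \<in> fin_vsets G" "A2 \<in> v X2" "basic_open G (ultra_limit G) X2 A2 \<subseteq> b"
      using Int by blast
    let ?X = "X1 \<union> X2"
    have X: "?X \<in> fin_vsets G" by (rule fin_vsets_Un[OF 1(1) 2(1)])
    define B where "B = {C \<in> comps G ?X. comp_map G ?X X1 C \<in> A1} \<inter> {C \<in> comps G ?X. comp_map G ?X X2 C \<in> A2}"
    have "B \<in> v ?X"
      unfolding B_def
      by (rule ultrafilter_onD(4)[OF uf[OF X] ultra_limit_pullback[OF v 1(1) X Un_upper1 1(2)]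
            ultra_limit_pullback[OF v 2(1) X Un_upper2 2(2)]])
    moreover have "basic_open G (ultra_limit G) ?X B \<subseteq> basic_open G (ultra_limit G) X1 A1"
      by (rule basic_open_refine[OF G 1(1) X Un_upper1 ultrafilter_onD(1)[OF uf[OF 1(1)] 1(2)]])
        (auto simp: B_def)
    moreover have "basic_open G (ultra_limit G) ?X B \<subseteq> basic_open G (ultra_limit G) X2 A2"
      by (rule basic_open_refine[OF G 2(1) X Un_upper2 ultrafilter_onD(1)[OF uf[OF 2(1)] 2(2)]])
        (auto simp: B_def)
    ultimately show ?case using X 1(3) 2(3) by blast
  next
    case (UN K)
    then obtain k where k: "k \<in> K" "Inr v \<in> k" by blast
    then obtain X A where "X \<in> fin_vsets G" "A \<in> v X" "basic_open G (ultra_limit G) X A \<subseteq> k"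
      using UN.IH by blast
    then show ?case using k(1) by blast
  next
    case (Basis s)
    then obtain X \<C> where s: "s = basic_open G (ultra_limit G) X \<C>" "X \<in> fin_vsets G" by blast
    then have "\<C> \<in> v X" using Basis(2) unfolding basic_open_def by blast
    then show ?case using s by blast
  qed simp
  then show thesis using that by blast
qed

section \<open>Continuity of the map on representatives\<close>

lemma Psi_id_rep_simps [simp]:
  "Psi_id_rep G (Inl x) = Inl x" "Psi_id_rep G (Inr v) = Inr (Psi_rep G v)"
  by (simp_all add: Psi_id_rep_def)

text \<open>Points of the graph are fixed and the graph parts of the two basic sets agree, so only
  the limit points matter, and these are settled by \<open>iff\<close>.\<close>

lemma Psi_id_rep_vimage_basic:
  assumes G: "simple_graph G" and A: "A \<subseteq> comps G X"
    and iff: "\<And>v. v \<in> ultra_limit G \<Longrightarrow> A \<in> Psi_rep G v X \<longleftrightarrow> A \<in> v X"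
  shows "{x \<in> topspace (theta G). Psi_id_rep G x \<in> basic_open G (crit_limit G) X A} =
    basic_open G (ultra_limit G) X A"
proof -
  have sub: "(\<Union>u\<in>\<Union>A. full_star G u) \<subseteq> realization G (verts G)"
    using openin_subset[OF openin_Union_full_star[OF A]] unfolding topspace_complex_topology[OF G] .
  show ?thesis
  proof (rule set_eqI)
    fix x show "x \<in> {x \<in> topspace (theta G). Psi_id_rep G x \<in> basic_open G (crit_limit G) X A} \<longleftrightarrow>
      x \<in> basic_open G (ultra_limit G) X A"
    proof (cases x)
      case (Inl a)
      have "Inl a \<in> topspace (theta G) \<longleftrightarrow> a \<in> realization G (verts G)"
        unfolding topspace_theta[OF G] by auto
      moreover have "Inl a \<in> basic_open G L X A \<longleftrightarrow> a \<in> (\<Union>u\<in>\<Union>A. full_star G u)" for L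
        using Inl_mem_basic_open[OF G A, of a L] by simp
      ultimately show ?thesis using Inl subsetD[OF sub, of a]
        by (simp only: Psi_id_rep_simps mem_Collect_eq) blast
    next
      case (Inr v)
      have "Inr v \<in> topspace (theta G) \<longleftrightarrow> v \<in> ultra_limit G"
        unfolding topspace_theta[OF G] by auto
      then show ?thesis using Inr iff Psi_rep_below(1)[of v G] by (auto simp: Inr_mem_basic_open)
    qed
  qed
qed

lemma Psi_rep_mem_singleton:
  assumes "v \<in> ultra_limit G" "X \<in> fin_vsets G" "C \<in> comps G X"
  shows "{C} \<in> Psi_rep G v X \<longleftrightarrow> {C} \<in> v X"
  by (rule crit_filters_mem_singleton[OF ultra_limitD(1)[OF assms(1,2)]
        crit_limitD(1)[OF Psi_rep_below(1)[OF assms(1)] assms(2)] Psi_rep_below(2)[OF assms(1,2)] assms(3)])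

lemma Psi_rep_mem_cofin:
  assumes "v \<in> ultra_limit G" "X \<in> fin_vsets G" "cofin_subset A (comps_with_nbhd G X Y)"
  shows "A \<in> Psi_rep G v X \<longleftrightarrow> A \<in> v X"
  by (rule crit_filters_mem_cofin[OF ultra_limitD(1)[OF assms(1,2)]
        crit_limitD(1)[OF Psi_rep_below(1)[OF assms(1)] assms(2)] Psi_rep_below(2)[OF assms(1,2)] assms(3)])

lemma cofin_subset_comps: "cofin_subset A (comps_with_nbhd G X Y) \<Longrightarrow> A \<subseteq> comps G X"
  using comps_with_nbhd_subset_comps[of G X Y] unfolding cofin_subset_def by blast

lemma Psi_id_rep_image:
  assumes "simple_graph G"
  shows "Psi_id_rep G ` topspace (theta G) = topspace (crit_space G)"
  unfolding topspace_theta[OF assms] topspace_crit_space[OF assms] Psi_rep_surj[symmetric]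
  by (auto simp: image_Un image_image)

lemma continuous_map_Psi_id_rep:
  assumes G: "simple_graph G"
  shows "continuous_map (theta G) (crit_space G) (Psi_id_rep G)"
  unfolding crit_space_def
proof (rule continuous_on_generated_topo)
  show "Psi_id_rep G ` topspace (theta G) \<subseteq>
    \<Union> ({Inl ` A | A. openin (complex_topology G) A} \<union>
      {basic_open G (crit_limit G) X {C} | X C. X \<in> fin_vsets G \<and> C \<in> comps G X} \<union>
      {basic_open G (crit_limit G) X \<C> | X \<C> Y. X \<in> fin_vsets G \<and> Y \<in> crit G X \<and>
         cofin_subset \<C> (comps_with_nbhd G X Y)})"
    using Psi_id_rep_image[OF G] unfolding crit_space_def topology_generated_by_topspace by simp
next
  fix S assume "S \<in> {Inl ` A | A. openin (complex_topology G) A} \<union>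
      {basic_open G (crit_limit G) X {C} | X C. X \<in> fin_vsets G \<and> C \<in> comps G X} \<union>
      {basic_open G (crit_limit G) X \<C> | X \<C> Y. X \<in> fin_vsets G \<and> Y \<in> crit G X \<and>
         cofin_subset \<C> (comps_with_nbhd G X Y)}"
  then have "openin (theta G) {x \<in> topspace (theta G). Psi_id_rep G x \<in> S}"
  proof (elim UnE CollectE exE conjE)
    fix A assume 1: "S = Inl ` A" "openin (complex_topology G) A"
    have "Psi_id_rep G x \<in> Inl ` A \<longleftrightarrow> x \<in> Inl ` A" for x
      by (cases x) auto
    then have "{x \<in> topspace (theta G). Psi_id_rep G x \<in> S} = Inl ` A"
      using openin_subset[OF openin_theta_Inl[OF 1(2)]] 1(1) by blast
    then show ?thesis using openin_theta_Inl[OF 1(2)] by simp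
  next
    fix X C
    assume "S = basic_open G (crit_limit G) X {C}" "X \<in> fin_vsets G" "C \<in> comps G X"
    then show ?thesis
      using Psi_id_rep_vimage_basic[OF G, of "{C}" X] Psi_rep_mem_singleton[of _ G X C]
        openin_theta_basic[of X G "{C}"] by simp
  next
    fix X \<C> Y
    assume 3: "S = basic_open G (crit_limit G) X \<C>" "X \<in> fin_vsets G"
      "cofin_subset \<C> (comps_with_nbhd G X Y)"
    show ?thesis
      using Psi_id_rep_vimage_basic[OF G cofin_subset_comps[OF 3(3)] Psi_rep_mem_cofin[OF _ 3(2,3)]]
        openin_theta_basic[OF 3(2) cofin_subset_comps[OF 3(3)]] 3(1) by simp
  qed
  moreover have "Psi_id_rep G -` S \<inter> topspace (theta G) = {x \<in> topspace (theta G). Psi_id_rep G x \<in> S}"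
    by blast
  ultimately show "openin (theta G) (Psi_id_rep G -` S \<inter> topspace (theta G))" by simp
qed

text \<open>This inclusion runs against \<open>basic_open_refine\<close>, from the smaller level to
  the larger one. It works because every member of \<open>A\<close> is a component at both levels,
  so the preimage of \<open>A\<close> under \<open>comp_map\<close> is contained in
  \<open>A\<close>.\<close>

lemma basic_open_least_refine:
  assumes G: "simple_graph G" and X: "X \<in> fin_vsets G" "Y \<subseteq> X"
    and A: "A \<subseteq> comps_with_nbhd G X Y"
  shows "basic_open G (ultra_limit G) Y A \<subseteq> basic_open G (ultra_limit G) X A"
proof -
  have Yf: "Y \<in> fin_vsets G" by (rule fin_vsets_subset[OF X])
  have AX: "A \<subseteq> comps G X" using A comps_with_nbhd_subset_comps[of G X Y] by blast
  have AY: "A \<subseteq> comps G Y"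
    using A comps_with_nbhd_antimono[of Y Y X G] X(2) comps_with_nbhd_subset_comps[of G Y Y] by blast
  have "A \<in> U X" if U: "U \<in> ultra_limit G" "A \<in> U Y" for U
  proof -
    have "{C \<in> comps G X. comp_map G X Y C \<in> A} \<subseteq> A"
    proof clarify
      fix C assume C: "C \<in> comps G X" "comp_map G X Y C \<in> A"
      have "comp_map G X Y C = C"
        using comps_superset_unique[OF comps_nonempty[OF C(1)] comp_map(2)[OF C(1) X(2)] subset_refl] AX C
        by blast
      then show "C \<in> A" using C(2) by simp
    qed
    then show ?thesis
      using ultrafilter_onD(5)[OF ultra_limitD(1)[OF U(1) X(1)] ultra_limit_pullback[OF U(1) Yf X U(2)]] AX
      by blast
  qed
  then show ?thesis by (rule basic_open_subsetI[OF G AY AX subset_refl])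
qed

lemma basic_open_Un:
  assumes G: "simple_graph G" and X: "X \<in> fin_vsets G" and AB: "A \<subseteq> comps G X" "B \<subseteq> comps G X"
  shows "basic_open G (ultra_limit G) X (A \<union> B) \<subseteq>
    basic_open G (ultra_limit G) X A \<union> basic_open G (ultra_limit G) X B"
proof -
  have un: "A \<in> U X \<or> B \<in> U X" if "U \<in> ultra_limit G" "A \<union> B \<in> U X" for U
    by (rule ultrafilter_on_Un[OF ultra_limitD(1)[OF that(1) X] that(2)])
  have ABX: "A \<union> B \<subseteq> comps G X" using AB by blast
  show ?thesis
  proof
    fix x assume x: "x \<in> basic_open G (ultra_limit G) X (A \<union> B)"
    show "x \<in> basic_open G (ultra_limit G) X A \<union> basic_open G (ultra_limit G) X B"
    proof (cases x)
      case (Inl a)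
      then show ?thesis
        using x Inl_mem_basic_open[OF G ABX] Inl_mem_basic_open[OF G AB(1)]
          Inl_mem_basic_open[OF G AB(2)] by auto
    next
      case (Inr F)
      then show ?thesis using x un[of F] by (auto simp: Inr_mem_basic_open)
    qed
  qed
qed

lemma basic_open_mono:
  assumes G: "simple_graph G" and X: "X \<in> fin_vsets G" and AB: "A \<subseteq> B" "B \<subseteq> comps G X"
  shows "basic_open G (ultra_limit G) X A \<subseteq> basic_open G (ultra_limit G) X B"
proof -
  have A: "A \<subseteq> comps G X" using AB by blast
  have "B \<in> U X" if "U \<in> ultra_limit G" "A \<in> U X" for U
    by (rule ultrafilter_onD(5)[OF ultra_limitD(1)[OF that(1) X] that(2) AB])
  then show ?thesis by (rule basic_open_subsetI[OF G A AB(2) Union_mono[OF AB(1)]])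
qed

text \<open>This is a compactness argument: the class of \<open>\<asymp>\<close> belonging to \<open>Y\<close> consists of the free ultrafilters
  on \<open>\<C>\<^sub>Y(Y)\<close>. If no cofinite set worked, some free ultrafilter would avoid the ideal of those
  \<open>\<C>\<close> whose basic open set lies in \<open>S\<close>.\<close>

lemma cofinite_basic_open_exists:
  assumes G: "simple_graph G" and F: "F \<in> crit_limit G" "least_nonprinc G F Y"
    and S: "openin (theta G) S"
    and cls: "\<And>v. v \<in> ultra_tangles G \<Longrightarrow> Psi_rep G v = F \<Longrightarrow> Inr v \<in> S"
  obtains A where "cofin_subset A (comps_with_nbhd G Y Y)" "basic_open G (ultra_limit G) Y A \<subseteq> S"
proof (rule ccontr)
  assume none: "\<not> thesis"
  let ?S = "comps_with_nbhd G Y Y" and ?B = "basic_open G (ultra_limit G)"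
  have Yf: "Y \<in> fin_vsets G" using F(2) by (simp add: least_nonprinc_def)
  have SY: "?S \<subseteq> comps G Y" by (rule comps_with_nbhd_subset_comps)
  \<comment> \<open>The finite summand \<open>N\<close> forces every ultrafilter avoiding
    \<open>J\<close> to be free, hence to come from a point of the class of
    \<open>F\<close>.\<close>
  define J where "J = {A \<union> N | A N. A \<subseteq> ?S \<and> ?B Y A \<subseteq> S \<and> finite N}"
  have "?B Y {} \<subseteq> S"
    using ultrafilter_onD(3)[OF ultra_limitD(1)[OF _ Yf]] unfolding basic_open_eq[OF G empty_subsetI] by auto
  then have fin: "N \<in> J" if "finite N" for N
    unfolding J_def using that by (intro CollectI exI[of _ "{}"] exI[of _ N]) simp
  have down: "B \<in> J" if J: "A' \<in> J" and BA: "B \<subseteq> A'" for A' B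
  proof -
    obtain A N where A: "A' = A \<union> N" "A \<subseteq> ?S" "?B Y A \<subseteq> S" "finite N" using J unfolding J_def by blast
    have "?B Y (A \<inter> B) \<subseteq> S" using basic_open_mono[OF G Yf, of "A \<inter> B" A] A(2,3) SY by blast
    moreover have "B = (A \<inter> B) \<union> (N \<inter> B)" "A \<inter> B \<subseteq> ?S" "finite (N \<inter> B)" using A BA by blast+
    ultimately show ?thesis unfolding J_def by blast
  qed
  have un: "A' \<union> B' \<in> J" if J: "A' \<in> J" "B' \<in> J" for A' B'
  proof -
    obtain A N where A: "A' = A \<union> N" "A \<subseteq> ?S" "?B Y A \<subseteq> S" "finite N" using J(1) unfolding J_def by blast
    obtain B M where B: "B' = B \<union> M" "B \<subseteq> ?S" "?B Y B \<subseteq> S" "finite M" using J(2) unfolding J_def by blast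
    have "?B Y (A \<union> B) \<subseteq> S" using basic_open_Un[OF G Yf, of A B] A(2,3) B(2,3) SY by blast
    moreover have "A' \<union> B' = (A \<union> B) \<union> (N \<union> M)" "A \<union> B \<subseteq> ?S" "finite (N \<union> M)"
      using A B by blast+
    ultimately show ?thesis unfolding J_def by blast
  qed
  have SJ: "?S \<notin> J"
  proof
    assume "?S \<in> J"
    then obtain A N where A: "?S = A \<union> N" "A \<subseteq> ?S" "?B Y A \<subseteq> S" "finite N" unfolding J_def by blast
    have "?S - A \<subseteq> N" using A(1) by blast
    then have "cofin_subset A ?S" using A(2,4) finite_subset unfolding cofin_subset_def by blast
    then show False using none that A(3) by blast
  qed
  obtain W where W: "ultrafilter_on ?S W" "W \<inter> J = {}"
  proof (rule ultrafilter_avoiding_ideal[of J ?S])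
    show "{} \<in> J" by (rule fin) simp
    show "B \<in> J" if "A \<in> J" "B \<subseteq> A" for A B using that by (rule down)
    show "A \<union> B \<in> J" if "A \<in> J" "B \<in> J" for A B using that by (rule un)
  qed (use SJ that in simp_all)
  have free: "A \<notin> W" if "finite A" for A using fin[OF that] W(2) by blast
  obtain v where v: "v \<in> ultra_tangles G" "X_of G v = Y" "Psi_rep G v = F"
    and vY: "\<And>A. A \<subseteq> comps G Y \<Longrightarrow> A \<in> v Y \<longleftrightarrow> A \<inter> ?S \<in> W"
    using free_ultrafilter_realized[OF F W(1) free] by metis
  have vU: "v \<in> ultra_limit G" using v(1) unfolding ultra_tangles_def by blast
  obtain X A where X: "X \<in> fin_vsets G" and A: "A \<in> v X" "?B X A \<subseteq> S"
    using theta_nbhd_base[OF G S cls[OF v(1,3)] vU] by metis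
  let ?Z = "X \<union> Y"
  have Z: "?Z \<in> fin_vsets G" by (rule fin_vsets_Un[OF X Yf])
  \<comment> \<open>The pullback of \<open>A\<close> is restricted to components with neighbourhood
    \<open>Y\<close> that also avoid \<open>X\<close>. These are components both at \<open>Y\<close>
    and at \<open>?Z\<close>, so \<open>B\<close> can be read at either level.\<close>
  define B where "B = {C \<in> comps G ?Z. comp_map G ?Z X C \<in> A} \<inter>
    {C \<in> comps G ?Z. comp_map G ?Z Y C \<in> comps_with_nbhd G ?Z Y}"
  have cof: "cofin_subset (comps_with_nbhd G ?Z Y) ?S"
    using comps_with_nbhd_antimono[of Y Y ?Z G] finite_comps_with_nbhd_diff[of ?Z Y G Y]
      fin_vsets_finite[OF Z] unfolding cofin_subset_def by simp
  have ZY: "comps_with_nbhd G ?Z Y \<subseteq> comps G Y" by (rule cofin_subset_comps[OF cof])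
  have "comps_with_nbhd G ?Z Y \<in> W"
    using cof free ultrafilter_onD(6)[OF W(1), of "comps_with_nbhd G ?Z Y"]
    unfolding cofin_subset_def by blast
  then have "comps_with_nbhd G ?Z Y \<in> v Y"
    using vY[OF ZY] cof unfolding cofin_subset_def by (simp add: Int_absorb2)
  then have BZ: "B \<in> v ?Z"
    unfolding B_def
    by (intro ultrafilter_onD(4)[OF ultra_limitD(1)[OF vU Z]] ultra_limit_pullback[OF vU X Z Un_upper1 A(1)]
        ultra_limit_pullback[OF vU Yf Z Un_upper2])
  have fixed: "comp_map G ?Z Y C = C" if "C \<in> B" for C
  proof -
    have C: "C \<in> comps G ?Z" and mC: "comp_map G ?Z Y C \<in> comps_with_nbhd G ?Z Y"
      using that unfolding B_def by blast+
    have "comp_map G ?Z Y C \<in> comps G ?Z" using mC comps_with_nbhd_subset_comps[of G ?Z Y] by blast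
    then show ?thesis
      using comps_superset_unique[OF comps_nonempty[OF C] comp_map(2)[OF C Un_upper2] subset_refl] C by blast
  qed
  have BS: "B \<subseteq> comps_with_nbhd G ?Z Y"
  proof
    fix C assume C: "C \<in> B"
    then have "comp_map G ?Z Y C \<in> comps_with_nbhd G ?Z Y" unfolding B_def by blast
    then show "C \<in> comps_with_nbhd G ?Z Y" using fixed[OF C] by simp
  qed
  have "comp_map G ?Z Y ` B \<subseteq> B" using fixed by auto
  moreover have BY: "B \<subseteq> comps G Y" using BS ZY by blast
  ultimately have "B \<in> ultra_map G ?Z Y (v ?Z)"
    unfolding mem_ultra_map using BZ by (intro conjI bexI[of _ B])
  then have "B \<in> v Y" using ultra_limitD(2)[OF vU Yf Z Un_upper2] by simp
  moreover have BSS: "B \<subseteq> ?S" using BS cof unfolding cofin_subset_def by blast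
  ultimately have "B \<in> W" using vY[OF BY] by (simp add: Int_absorb2)
  \<comment> \<open>Up from \<open>Y\<close> to the common level, then down to \<open>X\<close>:
    this puts \<open>B\<close> into \<open>J\<close>, although \<open>B\<close> belongs to
    \<open>W\<close>.\<close>
  have "?B Y B \<subseteq> ?B ?Z B" by (rule basic_open_least_refine[OF G Z Un_upper2 BS])
  also have "\<dots> \<subseteq> ?B X A"
    by (rule basic_open_refine[OF G X Z Un_upper1 ultrafilter_onD(1)[OF ultra_limitD(1)[OF vU X] A(1)]])
      (auto simp: B_def)
  finally have "?B Y B \<subseteq> S" using A(2) by blast
  then have "B \<in> J" using BSS unfolding J_def by (intro CollectI exI[of _ B] exI[of _ "{}"]) simp
  then show False using \<open>B \<in> W\<close> W(2) by blast
qed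

lemma quotient_map_Psi_id_rep:
  assumes G: "simple_graph G"
  shows "quotient_map (theta G) (crit_space G) (Psi_id_rep G)"
  unfolding quotient_map_def
proof (intro conjI allI impI iffI)
  show "Psi_id_rep G ` topspace (theta G) = topspace (crit_space G)" by (rule Psi_id_rep_image[OF G])
next
  fix S assume "openin (crit_space G) S"
  then show "openin (theta G) {x \<in> topspace (theta G). Psi_id_rep G x \<in> S}"
    by (rule openin_continuous_map_preimage[OF continuous_map_Psi_id_rep[OF G]])
next
  fix S assume S: "S \<subseteq> topspace (crit_space G)"
  let ?O = "{x \<in> topspace (theta G). Psi_id_rep G x \<in> S}"
  assume O: "openin (theta G) ?O"
  \<comment> \<open>If membership of \<open>A\<close> is the same in \<open>v X\<close> and in the
    filter below it, the basic set of \<open>theta G\<close> is the full preimage of that of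
    \<open>crit_space G\<close>; surjectivity then transports the inclusion.\<close>
  have lift: "basic_open G (crit_limit G) X A \<subseteq> S"
    if A: "A \<subseteq> comps G X" and iff: "\<And>v. v \<in> ultra_limit G \<Longrightarrow> A \<in> Psi_rep G v X \<longleftrightarrow> A \<in> v X"
      and sub: "basic_open G (ultra_limit G) X A \<subseteq> ?O"
      and top: "basic_open G (crit_limit G) X A \<subseteq> topspace (crit_space G)" for X A
  proof
    fix y assume y: "y \<in> basic_open G (crit_limit G) X A"
    then obtain x where x: "x \<in> topspace (theta G)" "y = Psi_id_rep G x"
      using top Psi_id_rep_image[OF G] by blast
    then have "x \<in> basic_open G (ultra_limit G) X A"
      using y Psi_id_rep_vimage_basic[OF G A iff] by blast
    then show "y \<in> S" using sub x(2) by blast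
  qed
  show "openin (crit_space G) S"
  proof (subst openin_subopen, intro ballI)
    fix y assume y: "y \<in> S"
    show "\<exists>T. openin (crit_space G) T \<and> y \<in> T \<and> T \<subseteq> S"
    proof (cases y)
      case (Inl a)
      let ?T = "Inl ` {x. Inl x \<in> ?O}"
      have "openin (crit_space G) ?T"
        by (rule openin_crit_space_Inl[OF openin_theta_Inl_vimage[OF G O]])
      moreover have "y \<in> topspace (theta G)"
        using y S Inl unfolding topspace_crit_space[OF G] topspace_theta[OF G] by blast
      then have "y \<in> ?T" using y Inl by simp
      moreover have "?T \<subseteq> S" by auto
      ultimately show ?thesis by blast
    next
      case (Inr F)
      then have F: "F \<in> crit_limit G" using y S unfolding topspace_crit_space[OF G] by blast
      show ?thesis
      proof (cases "F \<in> ends G")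
        case True
        have Fu: "F \<in> ultra_limit G" using True ends_subset_ultra_limit by blast
        then have FO: "Inr F \<in> ?O"
          using y Inr Psi_rep_end[OF True] unfolding topspace_theta[OF G] by simp
        obtain X A where X: "X \<in> fin_vsets G" and A: "A \<in> F X" "basic_open G (ultra_limit G) X A \<subseteq> ?O"
          by (rule theta_nbhd_base[OF G O FO Fu])
        \<comment> \<open>At an end the filter is principal, so \<open>A\<close> can be shrunk to a
          singleton, for which \<open>crit_space\<close> has a generator.\<close>
        obtain C where C: "C \<in> comps G X" "F X = princ G X C"
          using True X unfolding ends_def is_princ_def by blast
        have CA: "{C} \<subseteq> A" "A \<subseteq> comps G X" using A(1) C(2) by (auto simp: mem_princ)
        have op: "openin (crit_space G) (basic_open G (crit_limit G) X {C})"
          by (rule openin_crit_space_singleton[OF X C(1)])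
        have "basic_open G (crit_limit G) X {C} \<subseteq> S"
        proof (rule lift)
          show "{C} \<subseteq> comps G X" using C(1) by simp
          show "basic_open G (ultra_limit G) X {C} \<subseteq> ?O"
            using basic_open_mono[OF G X CA] A(2) by blast
          show "{C} \<in> Psi_rep G v X \<longleftrightarrow> {C} \<in> v X" if "v \<in> ultra_limit G" for v
            by (rule Psi_rep_mem_singleton[OF that X C(1)])
        qed (rule openin_subset[OF op])
        moreover have "y \<in> basic_open G (crit_limit G) X {C}"
          using Inr F C unfolding basic_open_def by (simp add: mem_princ)
        ultimately show ?thesis using op by blast
      next
        case False
        obtain Y where Y: "least_nonprinc G F Y" "Y \<in> crit G Y" "F Y = crit_filter G Y Y"
          using crit_limit_least_nonprinc_ex[OF F False] by metis
        have Yf: "Y \<in> fin_vsets G" using Y(1) by (simp add: least_nonprinc_def)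
        \<comment> \<open>The preimage \<open>?O\<close> is saturated: with one point over
          \<open>F\<close> it contains them all, as the compactness argument requires.\<close>
        have cls: "Inr v \<in> ?O" if "v \<in> ultra_tangles G" "Psi_rep G v = F" for v
          using that y Inr unfolding ultra_tangles_def topspace_theta[OF G] by simp
        obtain A where A: "cofin_subset A (comps_with_nbhd G Y Y)"
            "basic_open G (ultra_limit G) Y A \<subseteq> ?O"
          by (rule cofinite_basic_open_exists[OF G F Y(1) O cls])
        have op: "openin (crit_space G) (basic_open G (crit_limit G) Y A)"
          by (rule openin_crit_space_cofin[OF Yf Y(2) A(1)])
        have "basic_open G (crit_limit G) Y A \<subseteq> S"
          by (rule lift[OF cofin_subset_comps[OF A(1)] Psi_rep_mem_cofin[OF _ Yf A(1)] A(2)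
                openin_subset[OF op]])
        moreover have "A \<in> F Y"
          using A(1) cofin_subset_comps[OF A(1)] Y(3) unfolding cofin_subset_def
          by (simp add: mem_crit_filter)
        then have "y \<in> basic_open G (crit_limit G) Y A"
          using Inr F unfolding basic_open_def by simp
        ultimately show ?thesis using op by blast
      qed
    qed
  qed
qed

text \<open>With the relation recognised as the kernel of \<open>Psi_id_rep G\<close>, its being an
  equivalence, the independence of representatives and the injectivity on classes all
  follow.\<close>

lemma asymp_rel_iff:
  assumes "simple_graph G" "x \<in> topspace (theta G)" "y \<in> topspace (theta G)"
  shows "(x, y) \<in> asymp_rel G \<longleftrightarrow> Psi_id_rep G x = Psi_id_rep G y"
proof (cases x; cases y)
  fix v w assume xy: "x = Inr v" "y = Inr w"
  then have "v \<in> ultra_limit G" "w \<in> ultra_limit G"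
    using assms unfolding topspace_theta[OF assms(1)] by blast+
  then show ?thesis
    using Psi_rep_eq_iff[of v G w] xy assms(2) unfolding asymp_rel_def Id_on_def by auto
qed (use assms in \<open>auto simp: asymp_rel_def\<close>)

lemma asymp_rel_subset:
  assumes "simple_graph G"
  shows "asymp_rel G \<subseteq> topspace (theta G) \<times> topspace (theta G)"
  unfolding asymp_rel_def topspace_theta[OF assms] ultra_tangles_def by blast

lemma equiv_asymp_rel:
  assumes "simple_graph G"
  shows "equiv (topspace (theta G)) (asymp_rel G)"
proof (rule equivI)
  note iff = asymp_rel_iff[OF assms] and sub = asymp_rel_subset[OF assms]
  show "asymp_rel G \<subseteq> topspace (theta G) \<times> topspace (theta G)" by (rule sub)
  show "refl_on (topspace (theta G)) (asymp_rel G)" using iff by (auto intro: refl_onI)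
  show "sym (asymp_rel G)"
  proof (rule symI)
    fix x y assume "(x, y) \<in> asymp_rel G"
    then show "(y, x) \<in> asymp_rel G" using iff[of x y] iff[of y x] sub by auto
  qed
  show "trans (asymp_rel G)"
  proof (rule transI)
    fix x y z assume xyz: "(x, y) \<in> asymp_rel G" "(y, z) \<in> asymp_rel G"
    then have "x \<in> topspace (theta G)" "y \<in> topspace (theta G)" "z \<in> topspace (theta G)"
      using sub by auto
    then show "(x, z) \<in> asymp_rel G" using xyz iff by simp
  qed
qed

lemma Psi_id_rep_respects:
  assumes "simple_graph G"
  shows "Psi_id_rep G respects asymp_rel G"
proof (rule congruentI)
  fix x y assume xy: "(x, y) \<in> asymp_rel G"
  then have "x \<in> topspace (theta G)" "y \<in> topspace (theta G)" using asymp_rel_subset[OF assms] by blast+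
  then show "Psi_id_rep G x = Psi_id_rep G y" using asymp_rel_iff[OF assms] xy by blast
qed

lemma Psi_id_class:
  assumes "simple_graph G" "x \<in> topspace (theta G)"
  shows "Psi_id G (asymp_rel G `` {x}) = Psi_id_rep G x"
proof -
  have "Psi_id_rep G ` (asymp_rel G `` {x}) = {Psi_id_rep G x}"
  proof
    show "Psi_id_rep G ` (asymp_rel G `` {x}) \<subseteq> {Psi_id_rep G x}"
      using congruentD[OF Psi_id_rep_respects[OF assms(1)], of x] by auto
    have "x \<in> asymp_rel G `` {x}" using equiv_class_self[OF equiv_asymp_rel[OF assms(1)] assms(2)] .
    then show "{Psi_id_rep G x} \<subseteq> Psi_id_rep G ` (asymp_rel G `` {x})" by blast
  qed
  then show ?thesis by (simp add: Psi_id_def)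
qed

text \<open>Composed with the class map, \<open>Psi_id G\<close> is the quotient map
  \<open>Psi_id_rep G\<close>, so it is a quotient map itself; an injective quotient map is a
  homeomorphism.\<close>

lemma homeomorphic_map_Psi_id:
  assumes G: "simple_graph G"
  shows "homeomorphic_map (quotient_topology (theta G) (asymp_rel G)) (crit_space G) (Psi_id G)"
  unfolding homeomorphic_map_def
proof
  let ?cls = "\<lambda>x. asymp_rel G `` {x}"
  have "quotient_map (theta G) (crit_space G) (Psi_id G \<circ> ?cls)"
    by (rule quotient_map_eq[OF quotient_map_Psi_id_rep[OF G]]) (simp add: Psi_id_class[OF G])
  then show "quotient_map (quotient_topology (theta G) (asymp_rel G)) (crit_space G) (Psi_id G)"
    using quotient_map_compose_eq[OF quotient_map_class] by blast
  show "inj_on (Psi_id G) (topspace (quotient_topology (theta G) (asymp_rel G)))"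
    unfolding topspace_quotient_topology
  proof (rule inj_onI)
    fix K L assume KL: "K \<in> topspace (theta G) // asymp_rel G" "L \<in> topspace (theta G) // asymp_rel G"
      and eq: "Psi_id G K = Psi_id G L"
    obtain x where x: "x \<in> topspace (theta G)" "K = ?cls x" using KL(1) by (rule quotientE)
    obtain y where y: "y \<in> topspace (theta G)" "L = ?cls y" using KL(2) by (rule quotientE)
    have "(x, y) \<in> asymp_rel G"
      using asymp_rel_iff[OF G x(1) y(1)] eq Psi_id_class[OF G x(1)] Psi_id_class[OF G y(1)] x(2) y(2)
      by simp
    then show "K = L" using equiv_class_eq[OF equiv_asymp_rel[OF G]] x(2) y(2) by simp
  qed
qed

theorem theorem5p5p11:
  fixes G :: "'v ugraph"
  assumes "simple_graph G"
  shows "equiv (topspace (theta G)) (asymp_rel G)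
    \<and> (\<forall>v\<in>ultra_tangles G. least_nonprinc G v (X_of G v) \<and>
         (\<exists>!F. F \<in> crit_limit G - ends G \<and> least_nonprinc G F (X_of G v)))
    \<and> Psi_id_rep G respects asymp_rel G
    \<and> homeomorphic_map (quotient_topology (theta G) (asymp_rel G)) (crit_space G) (Psi_id G)"
proof (intro conjI ballI)
  show "equiv (topspace (theta G)) (asymp_rel G)" by (rule equiv_asymp_rel[OF assms])
  show "Psi_id_rep G respects asymp_rel G" by (rule Psi_id_rep_respects[OF assms])
  show "homeomorphic_map (quotient_topology (theta G) (asymp_rel G)) (crit_space G) (Psi_id G)"
    by (rule homeomorphic_map_Psi_id[OF assms])
  fix v assume v: "v \<in> ultra_tangles G"
  show "least_nonprinc G v (X_of G v)" by (rule ultra_tangle_props(1)[OF v])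
  show "\<exists>!F. F \<in> crit_limit G - ends G \<and> least_nonprinc G F (X_of G v)"
    by (rule ultra_tangle_props(2)[OF v])
qed

end
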